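(* There exists $C>0$ such that for every $b \in (-1,0]$ the (unweighted) Bergman projection $P$ satisfies $$\|P\|_{L^1_{\sigma_b}\rightarrow L^{1,\infty}_{\sigma_b}}\leq \frac{C}{1+b}\log\left(e+\frac{1}{1+b}\right).$$
   Context: $\mathbb{B}_n$ is the open unit ball of $\mathbb{C}^n$, $V$ is normalized Lebesgue measure on $\mathbb{B}_n$, $z\overline{w}=\sum_{j=1}^n z_j\overline{w}_j$, and $Pf(z)=\int_{\mathbb{B}_n}\frac{f(w)}{(1-z\overline{w})^{n+1}}\,dV(w)$. For $b>-1$, $\sigma_b(z)=c_b(1-|z|^2)^b$, where $c_b$ is the normalizing constant making $\int_{\mathbb{B}_n}\sigma_b\,dV=1$. For a weight $\sigma$, $\sigma(A)=\int_A\sigma\,dV$, $\|f\|_{L^1_\sigma}=\int_{\mathbb{B}_n}|f|\sigma\,dV$, $\|f\|_{L^{1,\infty}_\sigma}=\sup_{\lambda>0}\lambda\,\sigma(\{z:|f(z)|>\lambda\})$, and $\|P\|_{L^1_\sigma\to L^{1,\infty}_\sigma}$ is the smallest constant $A$ with $\|Pf\|_{L^{1,\infty}_\sigma}\le A\|f\|_{L^1_\sigma}$ for all $f\in L^1_\sigma$. *)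

theory Defs
  imports "HOL-Analysis.Analysis"
begin

text \<open>Normalized Lebesgue measure \<open>V\<close> on the open unit ball of \<open>\<complex>\<^sup>n\<close>. Its space is the
  ball itself, so the values of functions outside the ball never matter.\<close>

definition V_ball :: "(complex ^ 'n) measure" where
  "V_ball = uniform_measure (lebesgue_on (ball 0 1)) (ball 0 1)"

definition herm :: "complex ^ 'n \<Rightarrow> complex ^ 'n \<Rightarrow> complex" where
  "herm z w = (\<Sum>j\<in>UNIV. z $ j * cnj (w $ j))"

text \<open>The Bochner integral is \<open>0\<close> by convention where the integrand is not integrable. This does
  not occur for \<open>f \<in> L1 (std_weight b)\<close> with \<open>-1 < b \<le> 0\<close> and \<open>z\<close> in the ball:
  there the weight is bounded below by a positive constant and the kernel is bounded in \<open>w\<close>.\<close>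

definition bergman_projection ::
    "(complex ^ 'n \<Rightarrow> complex) \<Rightarrow> complex ^ 'n \<Rightarrow> complex" where
  "bergman_projection f z = (LINT w|V_ball. f w / (1 - herm z w) ^ (CARD('n) + 1))"

definition std_weight_const :: "'n::finite itself \<Rightarrow> real \<Rightarrow> real" where
  "std_weight_const _ b = 1 / (LINT z|(V_ball :: (complex ^ 'n) measure). (1 - (norm z)\<^sup>2) powr b)"

definition std_weight :: "real \<Rightarrow> complex ^ 'n \<Rightarrow> real" where
  "std_weight b z = std_weight_const TYPE('n) b * (1 - (norm z)\<^sup>2) powr b"

definition weight_mass :: "(complex ^ 'n \<Rightarrow> real) \<Rightarrow> (complex ^ 'n) set \<Rightarrow> ennreal" where
  "weight_mass \<sigma> A = (\<integral>\<^sup>+ z\<in>A. ennreal (\<sigma> z) \<partial>V_ball)"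

definition L1_norm :: "(complex ^ 'n \<Rightarrow> real) \<Rightarrow> (complex ^ 'n \<Rightarrow> complex) \<Rightarrow> ennreal" where
  "L1_norm \<sigma> f = (\<integral>\<^sup>+ z. ennreal (norm (f z) * \<sigma> z) \<partial>V_ball)"

definition L1 :: "(complex ^ 'n \<Rightarrow> real) \<Rightarrow> (complex ^ 'n \<Rightarrow> complex) set" where
  "L1 \<sigma> = {f \<in> borel_measurable V_ball. L1_norm \<sigma> f < \<infinity>}"

definition weak_L1_norm :: "(complex ^ 'n \<Rightarrow> real) \<Rightarrow> (complex ^ 'n \<Rightarrow> complex) \<Rightarrow> ennreal" where
  "weak_L1_norm \<sigma> f =
     (SUP t\<in>{0::real<..}. ennreal t * weight_mass \<sigma> {z \<in> ball 0 1. norm (f z) > t})"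

text \<open>The smallest admissible constant, with value \<open>\<infinity>\<close> if no finite constant is admissible.\<close>

definition weak_type_norm ::
    "(complex ^ 'n \<Rightarrow> real) \<Rightarrow> ((complex ^ 'n \<Rightarrow> complex) \<Rightarrow> (complex ^ 'n \<Rightarrow> complex)) \<Rightarrow> ennreal" where
  "weak_type_norm \<sigma> T = Inf {A. \<forall>f\<in>L1 \<sigma>. weak_L1_norm \<sigma> (T f) \<le> A * L1_norm \<sigma> f}"

end

theory Submission
  imports Defs
begin

text \<open>Both sides of a weak-type inequality for the weight \<open>std_weight b\<close> are linear in the weight, so
  its normalizing constant cancels and only the power \<open>defect z powr b\<close> of
  \<open>defect z = 1 - |z|\<^sup>2\<close> matters. Moreover \<open>|P f|\<close> is at most \<open>abs_proj |f|\<close>, where \<open>abs_proj\<close>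
  integrates against the modulus of the kernel, and the bound already holds for this positive
  operator.

  The unit ball is treated as a space of homogeneous type. The nonisotropic balls
  \<open>nball w r = {z. |1 - \<langle>z,w\<rangle>| < r}\<close> satisfy a quasi-triangle inequality, and the weight
  \<open>defect z powr b\<close> gives them mass at most \<open>C r powr (n + 1 + b) / (1 + b)\<close>
  (\<open>weighted_nball_volume\<close>). Splitting the ball according to the size of \<open>|1 - \<langle>z,w\<rangle>|\<close> replaces
  the kernel by averages over the balls of radius \<open>2 ^ m * defect z\<close>, for \<open>m = 0, 1, \<dots>\<close>
  (\<open>abs_kernel_dyadic\<close>).

  If \<open>b \<le> -1/2\<close>, these averages of the weight are dominated by a geometric series of ratio
  \<open>2 powr b \<le> 2 powr (-1/2)\<close>. Hence integrating the weight against the kernel gives at most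
  \<open>C / (1 + b)\<close> times the weight again, the operator is bounded on the weighted \<open>L\<^sup>1\<close>, and
  Markov's inequality finishes this range. The ratio tends to \<open>1\<close> as \<open>b\<close> tends to \<open>0\<close>, and at \<open>b = 0\<close>
  the operator is not bounded on \<open>L\<^sup>1\<close>.

  If \<open>b \<ge> -1/2\<close>, fix \<open>q < 1\<close>. A point where \<open>abs_proj g\<close> exceeds \<open>t\<close> must, for some \<open>m\<close>, be the
  centre of a ball of radius \<open>2 ^ m * defect z\<close> over which the average of \<open>g\<close> exceeds a multiple of
  \<open>t * q ^ m\<close>, since otherwise the geometric series would sum to at most \<open>t\<close>. For fixed \<open>m\<close>, a
  Vitali selection covers these points by enlarged balls with disjoint originals. This alone would
  lose the factor \<open>1 / q ^ m\<close>. But the defect of the points in question is at most \<open>2 / 2 ^ m\<close>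
  times the radius of the selected ball, so they lie in a thin layer of it whose mass is of order
  \<open>2 powr (-m/4)\<close> times that of the ball. With \<open>q = 2 powr (-1/8)\<close> the sum over \<open>m\<close> converges, with
  a constant independent of \<open>b\<close> (\<open>weak_type_Vitali_range\<close>).

  Both ranges together give the bound \<open>C / (1 + b)\<close>, and the logarithm in the theorem is at
  least \<open>1\<close> for all these exponents.\<close>

section \<open>Geometry of the kernel denominator\<close>

abbreviation defect :: "'a::real_normed_vector \<Rightarrow> real" where
  "defect z \<equiv> 1 - (norm z)\<^sup>2"

text \<open>These are the balls of the quasi-metric \<open>|1 - \<langle>z,w\<rangle>|\<close>: near the boundary they have size \<open>r\<close>
  in the complex direction of \<open>w\<close> and size \<open>sqrt r\<close> in the orthogonal directions. They do not
  contain their centre unless \<open>defect w < r\<close>.\<close>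

definition nball :: "complex ^ 'n \<Rightarrow> real \<Rightarrow> (complex ^ 'n) set" where
  "nball w r = {z \<in> ball 0 1. norm (1 - herm z w) < r}"

lemma norm_one_minus_herm_commute: "norm (1 - herm z w) = norm (1 - herm w z)"
proof -
  have "1 - herm z w = cnj (1 - herm w z)"
    by (simp add: herm_def mult.commute)
  then show ?thesis by (simp only: complex_mod_cnj)
qed

lemma Re_herm: "Re (herm z w) = z \<bullet> w"
  by (simp add: herm_def inner_vec_def inner_complex_def)

lemma Im_herm: "Im (herm z w) = z \<bullet> (\<chi> j. \<i> * w $ j)"
  by (simp add: herm_def inner_vec_def inner_complex_def algebra_simps)

lemma norm_rotate: "norm (\<chi> j. \<i> * w $ j) = norm (w :: complex ^ 'n)"
  by (simp add: norm_vec_def norm_mult)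

lemma inner_rotate: "w \<bullet> (\<chi> j. \<i> * w $ j) = 0"
  by (simp add: inner_vec_def inner_complex_def)

lemma norm_herm_le: "norm (herm z w) \<le> norm z * norm w"
proof -
  have "norm (herm z w) \<le> (\<Sum>j\<in>UNIV. norm (z $ j * cnj (w $ j)))"
    unfolding herm_def by (rule norm_sum)
  also have "\<dots> = (\<Sum>j\<in>UNIV. \<bar>norm (z $ j)\<bar> * \<bar>norm (w $ j)\<bar>)"
    by (simp add: norm_mult)
  also have "\<dots> \<le> norm z * norm w"
    unfolding norm_vec_def by (rule L2_set_mult_ineq)
  finally show ?thesis .
qed

lemma herm_diff_left: "herm (x - y) w = herm x w - herm y w"
  by (simp add: herm_def algebra_simps sum_subtractf)

lemma herm_diff_right: "herm w (x - y) = herm w x - herm w y"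
  by (simp add: herm_def algebra_simps sum_subtractf)

lemma herm_self: "herm z z = of_real ((norm z)\<^sup>2)"
proof -
  have "Re (herm z z) = (norm z)\<^sup>2" by (simp add: Re_herm power2_norm_eq_inner)
  moreover have "Im (herm z z) = 0" by (simp add: Im_herm inner_rotate)
  ultimately show ?thesis by (simp add: complex_eq_iff)
qed

lemma one_minus_norm_le:
  assumes "norm z \<le> 1"
  shows "1 - norm w \<le> norm (1 - herm z w)"
proof -
  have "norm (herm z w) \<le> 1 * norm w"
    using norm_herm_le[of z w] mult_right_mono[OF assms, of "norm w"] by simp
  then show ?thesis using norm_triangle_ineq2[of 1 "herm z w"] by simp
qed

lemma defect_le:
  assumes "norm z \<le> 1" "norm w \<le> 1"
  shows "1 - (norm w)\<^sup>2 \<le> 2 * norm (1 - herm z w)"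
proof -
  have "1 - (norm w)\<^sup>2 = (1 - norm w) * (1 + norm w)" by (simp add: power2_eq_square algebra_simps)
  also have "\<dots> \<le> (1 - norm w) * 2" using assms by (intro mult_left_mono) auto
  also have "\<dots> \<le> 2 * norm (1 - herm z w)" using one_minus_norm_le[OF assms(1), of w] by simp
  finally show ?thesis .
qed

text \<open>The quasi-metric controls the square of the Euclidean distance; this is what makes the error
  term in the quasi-triangle inequality harmless.\<close>

lemma norm_diff_le:
  assumes "norm z \<le> 1" "norm w \<le> 1"
  shows "(norm (z - w))\<^sup>2 \<le> 2 * norm (1 - herm z w)"
proof -
  have "(norm (z - w))\<^sup>2 = (norm z)\<^sup>2 + (norm w)\<^sup>2 - 2 * (z \<bullet> w)"
    by (simp add: power2_norm_eq_inner algebra_simps inner_commute)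
  also have "\<dots> \<le> 2 * (1 - z \<bullet> w)"
    using assms power_le_one[of "norm z" 2] power_le_one[of "norm w" 2] by simp
  also have "\<dots> = 2 * Re (1 - herm z w)" by (simp add: Re_herm)
  also have "\<dots> \<le> 2 * norm (1 - herm z w)" by (intro mult_left_mono complex_Re_le_cmod) auto
  finally show ?thesis .
qed

text \<open>Expanding around \<open>u\<close> gives
  \<open>1 - \<langle>z,w\<rangle> = (1 - \<langle>z,u\<rangle>) + (1 - \<langle>u,w\<rangle>) - (1 - |u|\<^sup>2) + \<langle>z - u, u - w\<rangle>\<close>. The third term is
  at most twice the first by \<open>defect_le\<close>, and the Cauchy-Schwarz inequality together with
  \<open>norm_diff_le\<close> bounds the last one by the sum of the first two.\<close>

lemma herm_quasi_triangle:
  assumes "norm z \<le> 1" "norm u \<le> 1" "norm w \<le> 1"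
  shows "norm (1 - herm z w) \<le> 4 * (norm (1 - herm z u) + norm (1 - herm u w))"
proof -
  define A where "A = norm (1 - herm z u)"
  define B where "B = norm (1 - herm u w)"
  have u1: "(norm u)\<^sup>2 \<le> 1" using assms by (simp add: power_le_one)
  have eq: "1 - herm z w =
      (1 - herm z u) + (1 - herm u w) - of_real (1 - (norm u)\<^sup>2) + herm (z - u) (u - w)"
    by (simp add: herm_diff_left herm_diff_right herm_self)
  have "norm (herm (z - u) (u - w)) \<le> norm (z - u) * norm (u - w)" by (rule norm_herm_le)
  also have "\<dots> \<le> ((norm (z - u))\<^sup>2 + (norm (u - w))\<^sup>2) / 2"
    using sum_squares_bound[of "norm (z - u)" "norm (u - w)"] by simp
  also have "\<dots> \<le> A + B"
    using norm_diff_le[OF assms(1,2)] norm_diff_le[OF assms(2,3)] by (simp add: A_def B_def)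
  finally have 1: "norm (herm (z - u) (u - w)) \<le> A + B" .
  have 2: "norm (of_real (1 - (norm u)\<^sup>2) :: complex) \<le> 2 * A"
    using defect_le[OF assms(1,2)] u1 unfolding norm_of_real by (simp add: A_def)
  have "norm (1 - herm z w) \<le> A + B + 2 * A + (A + B)"
    unfolding eq using 1 2
      norm_triangle_ineq[of "1 - herm z u" "1 - herm u w"]
      norm_triangle_ineq4[of "(1 - herm z u) + (1 - herm u w)" "of_real (1 - (norm u)\<^sup>2)"]
      norm_triangle_ineq[of "(1 - herm z u) + (1 - herm u w) - of_real (1 - (norm u)\<^sup>2)" "herm (z - u) (u - w)"]
    unfolding A_def B_def by linarith
  also have "\<dots> \<le> 4 * (A + B)" by (simp add: A_def B_def)
  finally show ?thesis by (simp add: A_def B_def)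
qed

section \<open>Vitali selection\<close>

text \<open>A maximal disjoint subfamily need not control the radii of the sets that it meets. So the
  Zorn argument runs over disjoint subfamilies with the extra property that every set meeting the
  subfamily meets a member of at least half its radius. In a maximal one nothing is left over:
  among the sets disjoint from all members, one whose radius is more than half the supremum could
  be added without destroying that property.\<close>

lemma Vitali_selection:
  fixes U :: "'a \<Rightarrow> 'b set" and r :: "'a \<Rightarrow> real"
  assumes pos: "\<And>x. x \<in> S \<Longrightarrow> 0 < r x \<and> r x \<le> R"
    and ne: "\<And>x. x \<in> S \<Longrightarrow> U x \<noteq> {}"
  obtains D where "D \<subseteq> S" "disjoint_family_on U D"
    "\<And>x. x \<in> S \<Longrightarrow> \<exists>y\<in>D. U x \<inter> U y \<noteq> {} \<and> r x \<le> 2 * r y"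
proof -
  define \<F> where "\<F> = {D. D \<subseteq> S \<and> disjoint_family_on U D \<and>
    (\<forall>x\<in>S. (\<exists>y\<in>D. U x \<inter> U y \<noteq> {}) \<longrightarrow> (\<exists>y\<in>D. U x \<inter> U y \<noteq> {} \<and> r x \<le> 2 * r y))}"
  have "\<exists>M\<in>\<F>. \<forall>X\<in>\<F>. M \<subseteq> X \<longrightarrow> X = M"
  proof (rule subset_Zorn')
    fix C assume C: "subset.chain \<F> C"
    then have sub: "C \<subseteq> \<F>" and lin: "\<And>X Y. X \<in> C \<Longrightarrow> Y \<in> C \<Longrightarrow> X \<subseteq> Y \<or> Y \<subseteq> X"
      by (auto simp: subset_chain_def)
    have "disjoint_family_on U (\<Union>C)"
      unfolding disjoint_family_on_def
    proof (intro ballI impI)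
      fix x y assume xy: "x \<in> \<Union>C" "y \<in> \<Union>C" "x \<noteq> y"
      then obtain X where "X \<in> C" "x \<in> X" "y \<in> X" using lin by blast
      then show "U x \<inter> U y = {}"
        using xy sub by (auto simp: \<F>_def disjoint_family_on_def)
    qed
    moreover have "\<Union>C \<subseteq> S" using sub by (auto simp: \<F>_def)
    moreover have "\<exists>y\<in>\<Union>C. U x \<inter> U y \<noteq> {} \<and> r x \<le> 2 * r y"
      if x: "x \<in> S" and ex: "\<exists>y\<in>\<Union>C. U x \<inter> U y \<noteq> {}" for x
    proof -
      obtain X y where "X \<in> C" "y \<in> X" "U x \<inter> U y \<noteq> {}" using ex by blast
      moreover then have "X \<in> \<F>" using sub by blast
      ultimately have "\<exists>y\<in>X. U x \<inter> U y \<noteq> {} \<and> r x \<le> 2 * r y"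
        using x unfolding \<F>_def by blast
      then show ?thesis using \<open>X \<in> C\<close> by blast
    qed
    ultimately show "\<Union>C \<in> \<F>" by (simp add: \<F>_def)
  qed
  then obtain D where D: "D \<in> \<F>" and max: "\<And>X. X \<in> \<F> \<Longrightarrow> D \<subseteq> X \<Longrightarrow> X = D" by blast
  define Z where "Z = {x \<in> S. \<forall>y\<in>D. U x \<inter> U y = {}}"
  \<comment> \<open>\<open>Z\<close> collects the indices whose sets are disjoint from all members of the maximal family.\<close>
  have "Z = {}"
  proof (rule ccontr)
    assume Zne: "Z \<noteq> {}"
    have bdd: "bdd_above (r ` Z)" using pos by (auto simp: Z_def intro!: bdd_aboveI[of _ R])
    obtain z0 where z0: "z0 \<in> Z" using Zne by blast
    have "0 < r z0" using z0 pos by (auto simp: Z_def)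
    also have "r z0 \<le> Sup (r ` Z)" using z0 bdd by (intro cSup_upper) auto
    finally have "Sup (r ` Z) / 2 < Sup (r ` Z)" by simp
    then obtain z where z: "z \<in> Z" "Sup (r ` Z) / 2 < r z"
      using less_cSupD[of "r ` Z" "Sup (r ` Z) / 2"] Zne by blast
    have big: "r x \<le> 2 * r z" if "x \<in> Z" for x
    proof -
      have "r x \<le> Sup (r ` Z)" using that bdd by (intro cSup_upper) auto
      then show ?thesis using z by simp
    qed
    have "insert z D \<in> \<F>"
    proof -
      have "disjoint_family_on U (insert z D)"
        using D z(1) unfolding \<F>_def Z_def disjoint_family_on_def by blast
      moreover have "\<exists>y\<in>insert z D. U x \<inter> U y \<noteq> {} \<and> r x \<le> 2 * r y"
        if x: "x \<in> S" and ex: "\<exists>y\<in>insert z D. U x \<inter> U y \<noteq> {}" for x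
      proof (cases "x \<in> Z")
        case True
        then have "U x \<inter> U z \<noteq> {}" using ex by (auto simp: Z_def)
        then show ?thesis using big[OF True] by blast
      next
        case False
        then have "\<exists>y\<in>D. U x \<inter> U y \<noteq> {}" using x by (auto simp: Z_def)
        then have "\<exists>y\<in>D. U x \<inter> U y \<noteq> {} \<and> r x \<le> 2 * r y"
          using D x unfolding \<F>_def by blast
        then show ?thesis by blast
      qed
      moreover have "insert z D \<subseteq> S" using D z(1) by (auto simp: \<F>_def Z_def)
      ultimately show ?thesis by (simp add: \<F>_def)
    qed
    then have "z \<in> D" using max[of "insert z D"] by blast
    then have "U z \<inter> U z = {}" using z(1) unfolding Z_def by blast
    then show False using ne[of z] z(1) by (auto simp: Z_def)
  qed
  show thesis
  proof (rule that)
    show "D \<subseteq> S" "disjoint_family_on U D" using D by (auto simp: \<F>_def)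
    fix x assume "x \<in> S"
    then have "\<exists>y\<in>D. U x \<inter> U y \<noteq> {}" using \<open>Z = {}\<close> by (auto simp: Z_def)
    then show "\<exists>y\<in>D. U x \<inter> U y \<noteq> {} \<and> r x \<le> 2 * r y"
      using D \<open>x \<in> S\<close> unfolding \<F>_def by blast
  qed
qed

section \<open>Weighted volumes of nonisotropic balls\<close>

text \<open>Fubini's theorem along a line, in a form that needs no coordinates adapted to the direction
  \<open>u\<close>: by translation invariance, the integral of \<open>g\<close> is the average over \<open>t \<in> [0, T]\<close> of the
  integrals of its translates by \<open>t u\<close>, and the \<open>t\<close>-integral is estimated first. The volume
  estimates below use it in place of a rotation moving \<open>w\<close> to a coordinate axis.\<close>

lemma averaging_bound:
  fixes g :: "'a::euclidean_space \<Rightarrow> ennreal" and u :: 'a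
  assumes g[measurable]: "g \<in> borel_measurable borel" and A[measurable]: "A \<in> sets borel" and T: "0 < T"
    and le: "\<And>z. (\<integral>\<^sup>+t. g (z + t *\<^sub>R u) * indicator {0..T} t \<partial>lborel) \<le> M * indicator A z"
  shows "(\<integral>\<^sup>+z. g z \<partial>lborel) \<le> M / ennreal T * emeasure lborel A"
proof -
  have shift: "(\<integral>\<^sup>+z. g (z + v) \<partial>lborel) = (\<integral>\<^sup>+z. g z \<partial>lborel)" for v
  proof -
    have "(\<integral>\<^sup>+z. g z \<partial>lborel) = (\<integral>\<^sup>+z. g z \<partial>distr lborel borel (\<lambda>z. v + z))"
      by (simp add: lborel_distr_plus)
    also have "\<dots> = (\<integral>\<^sup>+z. g (v + z) \<partial>lborel)" by (rule nn_integral_distr) auto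
    finally show ?thesis by (simp add: add.commute)
  qed
  have "ennreal T * (\<integral>\<^sup>+z. g z \<partial>lborel) = (\<integral>\<^sup>+t. (\<integral>\<^sup>+z. g z \<partial>lborel) * indicator {0..T} t \<partial>lborel)"
    using T by (subst nn_integral_cmult) (auto simp: mult.commute)
  also have "\<dots> = (\<integral>\<^sup>+t. (\<integral>\<^sup>+z. g (z + t *\<^sub>R u) * indicator {0..T} t \<partial>lborel) \<partial>lborel)"
    by (intro nn_integral_cong, subst nn_integral_multc) (auto simp: shift)
  also have "\<dots> = (\<integral>\<^sup>+z. (\<integral>\<^sup>+t. g (z + t *\<^sub>R u) * indicator {0..T} t \<partial>lborel) \<partial>lborel)"
    by (rule lborel_pair.Fubini') simp
  also have "\<dots> \<le> (\<integral>\<^sup>+z. M * indicator A z \<partial>lborel)" by (intro nn_integral_mono le)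
  also have "\<dots> = M * emeasure lborel A" by (subst nn_integral_cmult) auto
  finally have "ennreal T * (\<integral>\<^sup>+z. g z \<partial>lborel) / ennreal T \<le> M * emeasure lborel A / ennreal T"
    by (rule divide_right_mono_ennreal)
  then show ?thesis
    using T by (simp add: ennreal_mult_divide_eq mult.commute[of "ennreal T"]
        ennreal_divide_times ennreal_times_divide)
qed

text \<open>A set inside the slab \<open>|z \<bullet> u - a| \<le> \<rho>\<close> meets each line in direction \<open>u\<close> in a parameter set
  of length at most \<open>2 \<rho> / |u|\<^sup>2\<close>. So its volume is at most this length divided by \<open>T\<close>
  times the volume of the region \<open>A\<close> that it sweeps out when moved back by up to \<open>T\<close>.\<close>

lemma slab_bound:
  fixes u :: "'a::euclidean_space"
  assumes S[measurable]: "S \<in> sets borel" and A: "A \<in> sets borel" and T: "0 < T" and u: "u \<noteq> 0"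
    and \<rho>: "0 \<le> \<rho>"
    and slab: "\<And>z. z \<in> S \<Longrightarrow> \<bar>z \<bullet> u - a\<bar> \<le> \<rho>"
    and sub: "\<And>z t. 0 \<le> t \<Longrightarrow> t \<le> T \<Longrightarrow> z + t *\<^sub>R u \<in> S \<Longrightarrow> z \<in> A"
  shows "emeasure lborel S \<le> ennreal (2 * \<rho> / (norm u)\<^sup>2) / ennreal T * emeasure lborel A"
proof -
  have "(\<integral>\<^sup>+z. indicator S z \<partial>lborel) \<le> ennreal (2 * \<rho> / (norm u)\<^sup>2) / ennreal T * emeasure lborel A"
  proof (rule averaging_bound[OF _ A T, where u=u])
    fix z
    define p where "p = (a - \<rho> - z \<bullet> u) / (norm u)\<^sup>2"
    define q where "q = (a + \<rho> - z \<bullet> u) / (norm u)\<^sup>2"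
    have u2: "0 < (norm u)\<^sup>2" using u by simp
    have len: "q - p = 2 * \<rho> / (norm u)\<^sup>2"
      by (simp add: p_def q_def diff_divide_distrib[symmetric])
    then have pq: "p \<le> q" using \<rho> u2 by (metis diff_ge_0_iff_ge divide_nonneg_pos mult_nonneg_nonneg zero_le_numeral)
    have "(\<integral>\<^sup>+t. indicator S (z + t *\<^sub>R u) * indicator {0..T} t \<partial>lborel)
        \<le> (\<integral>\<^sup>+t. indicator A z * indicator {p..q} t \<partial>lborel)"
    proof (rule nn_integral_mono)
      fix t
      show "indicator S (z + t *\<^sub>R u) * indicator {0..T} t \<le> (indicator A z * indicator {p..q} t :: ennreal)"
      proof (cases "0 \<le> t \<and> t \<le> T \<and> z + t *\<^sub>R u \<in> S")
        case True
        have "\<bar>z \<bullet> u + t * (norm u)\<^sup>2 - a\<bar> \<le> \<rho>"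
          using slab[of "z + t *\<^sub>R u"] True by (simp add: inner_add_left power2_norm_eq_inner)
        then have "p \<le> t" "t \<le> q"
          unfolding p_def q_def using u2 by (auto simp: pos_divide_le_eq pos_le_divide_eq)
        then show ?thesis using sub[of t z] True by simp
      qed (auto simp: indicator_def)
    qed
    also have "\<dots> = ennreal (2 * \<rho> / (norm u)\<^sup>2) * indicator A z"
      using pq len by (simp add: nn_integral_cmult mult.commute)
    finally show "(\<integral>\<^sup>+t. indicator S (z + t *\<^sub>R u) * indicator {0..T} t \<partial>lborel)
       \<le> ennreal (2 * \<rho> / (norm u)\<^sup>2) * indicator A z" .
  qed measurable
  then show ?thesis by simp
qed

lemma nn_integral_powr_reflected:
  fixes b \<tau> :: real
  assumes "-1 < b" "0 \<le> \<tau>"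
  shows "(\<integral>\<^sup>+t. ennreal ((\<tau> - t) powr b) * indicator {0..\<tau>} t \<partial>lborel) = ennreal (\<tau> powr (1 + b) / (1 + b))"
proof -
  have "((\<lambda>x. x powr b) has_integral \<tau> powr (1 + b) / (1 + b)) {0..\<tau>}"
    using has_integral_powr_from_0[of b \<tau>] assms by (simp add: add.commute)
  then have "(\<integral>\<^sup>+x. ennreal (x powr b) * indicator {0..\<tau>} x \<partial>lborel) = ennreal (\<tau> powr (1 + b) / (1 + b))"
    by (intro nn_integral_has_integral_lebesgue') auto
  then show ?thesis
    by (subst (asm) nn_integral_real_affine[of _ "-1" \<tau>])
       (auto simp: indicator_def if_distrib conj_commute cong: if_cong)
qed

text \<open>Along the direction \<open>w\<close> the defect decreases at unit speed or faster, because
  \<open>x \<bullet> w \<ge> 1/2\<close>. If \<open>\<tau>\<close> is the last time the line meets \<open>B\<close>, the defect at time \<open>t\<close> is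
  therefore at least \<open>\<tau> - t\<close>, which reduces the integral to that of a power. This is the source
  of the factor \<open>1 / (1 + b)\<close> in the volume bounds.\<close>

lemma radial_slice_bound:
  fixes z w :: "'a::euclidean_space" and b r :: real
  assumes b: "-1 < b" "b \<le> 0" and r: "0 < r"
    and B: "\<And>x. x \<in> B \<Longrightarrow> norm x \<le> 1 \<and> 1 / 2 \<le> x \<bullet> w"
  shows "(\<integral>\<^sup>+t. ennreal (defect (z + t *\<^sub>R w) powr b) * indicator B (z + t *\<^sub>R w) * indicator {0..r} t \<partial>lborel)
    \<le> ennreal (r powr (1 + b) / (1 + b))"
proof -
  define I where "I = {t. 0 \<le> t \<and> t \<le> r \<and> z + t *\<^sub>R w \<in> B}"
  show ?thesis
  proof (cases "I = {}")
    case True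
    then have "(\<lambda>t. ennreal (defect (z + t *\<^sub>R w) powr b) * indicator B (z + t *\<^sub>R w) * indicator {0..r} t) = (\<lambda>t. 0)"
      by (auto simp: I_def indicator_def fun_eq_iff)
    then show ?thesis by simp
  next
    case False
    define \<tau> where "\<tau> = Sup I"
    have bdd: "bdd_above I" by (auto simp: I_def intro: bdd_aboveI[of _ r])
    have \<tau>: "t \<le> \<tau>" if "t \<in> I" for t using that bdd by (simp add: \<tau>_def cSup_upper)
    have "\<tau> \<le> r" unfolding \<tau>_def by (rule cSup_least[OF False]) (simp add: I_def)
    have "0 \<le> \<tau>" using False \<tau> by (force simp: I_def)
    have defect: "\<tau> - t \<le> 1 - (norm (z + t *\<^sub>R w))\<^sup>2" if t: "t \<in> I" for t
    proof -
      have "s \<le> t + (1 - (norm (z + t *\<^sub>R w))\<^sup>2)" if s: "s \<in> I" for s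
      proof (cases "s \<le> t")
        case True
        have "(norm (z + t *\<^sub>R w))\<^sup>2 \<le> 1" using B t by (auto simp: I_def power_le_one)
        then show ?thesis using True by simp
      next
        case False
        have "1 \<le> (z + s *\<^sub>R w) \<bullet> w + (z + t *\<^sub>R w) \<bullet> w"
          using B[of "z + s *\<^sub>R w"] B[of "z + t *\<^sub>R w"] s t by (simp add: I_def)
        then have "(s - t) * 1 \<le> (s - t) * ((z + s *\<^sub>R w) \<bullet> w + (z + t *\<^sub>R w) \<bullet> w)"
          using False by (intro mult_left_mono) auto
        also have "\<dots> = (norm (z + s *\<^sub>R w))\<^sup>2 - (norm (z + t *\<^sub>R w))\<^sup>2"
          by (simp add: power2_norm_eq_inner algebra_simps inner_commute)
        also have "\<dots> \<le> 1 - (norm (z + t *\<^sub>R w))\<^sup>2"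
          using B[of "z + s *\<^sub>R w"] s by (simp add: I_def power_le_one)
        finally show ?thesis by simp
      qed
      then have "\<tau> \<le> t + (1 - (norm (z + t *\<^sub>R w))\<^sup>2)"
        unfolding \<tau>_def by (intro cSup_least[OF False])
      then show ?thesis by simp
    qed
    have "(\<integral>\<^sup>+t. ennreal (defect (z + t *\<^sub>R w) powr b) * indicator B (z + t *\<^sub>R w) * indicator {0..r} t \<partial>lborel)
      \<le> (\<integral>\<^sup>+t. ennreal ((\<tau> - t) powr b) * indicator {0..\<tau>} t \<partial>lborel)"
    proof (rule nn_integral_mono_AE, rule eventually_mono[OF AE_lborel_singleton[of \<tau>]])
      fix t :: real assume "t \<noteq> \<tau>"
      show "ennreal (defect (z + t *\<^sub>R w) powr b) * indicator B (z + t *\<^sub>R w) * indicator {0..r} t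
        \<le> ennreal ((\<tau> - t) powr b) * indicator {0..\<tau>} t"
      proof (cases "t \<in> I")
        case True
        then have "0 < \<tau> - t" using \<tau>[of t] \<open>t \<noteq> \<tau>\<close> by simp
        then have "defect (z + t *\<^sub>R w) powr b \<le> (\<tau> - t) powr b"
          using defect[OF True] b by (intro powr_mono2') auto
        then show ?thesis using True \<tau>[of t] by (simp add: I_def ennreal_leI)
      qed (auto simp: I_def indicator_def)
    qed
    also have "\<dots> = ennreal (\<tau> powr (1 + b) / (1 + b))"
      using b \<open>0 \<le> \<tau>\<close> by (intro nn_integral_powr_reflected)
    also have "\<dots> \<le> ennreal (r powr (1 + b) / (1 + b))"
      using b \<open>0 \<le> \<tau>\<close> \<open>\<tau> \<le> r\<close> by (intro ennreal_leI divide_right_mono powr_mono2) auto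
    finally show ?thesis .
  qed
qed

lemma continuous_on_herm [continuous_intros]:
  assumes "continuous_on S f" "continuous_on S g"
  shows "continuous_on S (\<lambda>x. herm (f x) (g x))"
  unfolding herm_def by (intro continuous_intros assms)

lemma open_nball: "open (nball w r)"
proof -
  have "nball w r = ball 0 1 \<inter> {z. norm (1 - herm z w) < r}" by (auto simp: nball_def)
  moreover have "open {z. norm (1 - herm z w) < r}"
    by (intro open_Collect_less continuous_intros)
  ultimately show ?thesis by auto
qed

lemma nball_borel [measurable]: "nball w r \<in> sets borel"
  using open_nball by (rule borel_open)

text \<open>The factor \<open>64\<close> comes from two slabs that cost \<open>8 * sqrt r\<close> each, and \<open>16 ^ n\<close> from a
  Euclidean ball of radius \<open>4 * sqrt r\<close> in real dimension \<open>2 n\<close>.\<close>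

definition nball_volume_const :: "'n::finite itself \<Rightarrow> real" where
  "nball_volume_const _ = 64 * 16 ^ CARD('n) * unit_ball_vol (real (2 * CARD('n)))"

text \<open>The box lies in a Euclidean ball of radius comparable to \<open>sqrt r\<close>, whose volume is of order
  \<open>r ^ n\<close>, and in two orthogonal slabs of thickness of order \<open>r\<close>, normal to \<open>w\<close> and \<open>i w\<close>.
  Each slab gains a factor of order \<open>sqrt r\<close>. Moving along \<open>w\<close> does not leave the slab normal to
  \<open>i w\<close>, so the two gains multiply.\<close>

lemma nball_box_volume:
  fixes w :: "complex ^ 'n"
  assumes r: "0 < r" and w: "1 / 2 \<le> (norm w)\<^sup>2" "norm w \<le> 1"
  shows "emeasure lborel {z. \<bar>z \<bullet> w - 1\<bar> \<le> 2 * r \<and> \<bar>z \<bullet> (\<chi> j. \<i> * w $ j)\<bar> \<le> 2 * r \<and> norm (z - w) \<le> 2 * sqrt r}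
    \<le> ennreal (nball_volume_const TYPE('n) * r ^ (CARD('n) + 1))"
proof -
  define w' where "w' = (\<chi> j. \<i> * w $ j)"
  have w'1: "norm w' = norm w" and orth: "w \<bullet> w' = 0"
    by (simp_all add: w'_def norm_rotate inner_rotate)
  have w0: "w \<noteq> 0" "w' \<noteq> 0" using w w'1 by auto
  define S where "S = {z. \<bar>z \<bullet> w - 1\<bar> \<le> 2 * r \<and> \<bar>z \<bullet> w'\<bar> \<le> 2 * r \<and> norm (z - w) \<le> 2 * sqrt r}"
  define S' where "S' = {z. \<bar>z \<bullet> w'\<bar> \<le> 2 * r \<and> norm (z - w) \<le> 3 * sqrt r}"
  have S[measurable]: "S \<in> sets borel" unfolding S_def by measurable
  have S'[measurable]: "S' \<in> sets borel" unfolding S'_def by measurable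
  have s: "0 < sqrt r" using r by simp
  have move: "norm (z - w) \<le> (c + 1) * sqrt r"
    if "0 \<le> t" "t \<le> sqrt r" "norm (z + t *\<^sub>R v - w) \<le> c * sqrt r" "norm v \<le> 1" for z v t c
  proof -
    have "norm (z - w) \<le> norm (z + t *\<^sub>R v - w) + norm (t *\<^sub>R v)"
      using norm_triangle_ineq4[of "z + t *\<^sub>R v - w" "t *\<^sub>R v"] by (simp add: algebra_simps)
    moreover have "norm (t *\<^sub>R v) \<le> sqrt r * 1"
      using that s unfolding norm_scaleR by (intro mult_mono) auto
    ultimately show ?thesis using that by (simp add: algebra_simps)
  qed
  have coeff: "ennreal (2 * (2 * r) / (norm w)\<^sup>2) / ennreal (sqrt r) \<le> ennreal (8 * sqrt r)"
  proof -
    have "2 * (2 * r) / (norm w)\<^sup>2 \<le> 2 * (2 * r) / (1 / 2)"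
      using r w by (intro divide_left_mono) (auto intro: mult_pos_pos)
    then have "2 * (2 * r) / (norm w)\<^sup>2 / sqrt r \<le> 8 * r / sqrt r"
      using s by (intro divide_right_mono) auto
    also have "\<dots> = 8 * sqrt r" using r real_div_sqrt[of r] by (simp only: times_divide_eq_right[symmetric])
    finally show ?thesis using s r by (simp add: divide_ennreal)
  qed
  have "emeasure lborel S \<le> ennreal (2 * (2 * r) / (norm w)\<^sup>2) / ennreal (sqrt r) * emeasure lborel S'"
  proof (rule slab_bound[OF S S' s w0(1), where a=1])
    fix z t assume "0 \<le> t" "t \<le> sqrt r" "z + t *\<^sub>R w \<in> S"
    then show "z \<in> S'"
      using move[of t z w 2] w(2) by (simp add: S_def S'_def inner_add_left orth)
  qed (use r in \<open>auto simp: S_def\<close>)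
  also have "\<dots> \<le> ennreal (8 * sqrt r) * emeasure lborel S'"
    by (intro mult_right_mono coeff) simp
  also have "emeasure lborel S' \<le> ennreal (2 * (2 * r) / (norm w')\<^sup>2) / ennreal (sqrt r) * emeasure lborel (cball w (4 * sqrt r))"
  proof (rule slab_bound[OF S' _ s w0(2), where a=0])
    fix z t assume "0 \<le> t" "t \<le> sqrt r" "z + t *\<^sub>R w' \<in> S'"
    then show "z \<in> cball w (4 * sqrt r)"
      using move[of t z w' 3] w(2) w'1 by (simp add: S'_def dist_norm norm_minus_commute)
  qed (use r in \<open>auto simp: S'_def\<close>)
  also have "\<dots> \<le> ennreal (8 * sqrt r) * emeasure lborel (cball w (4 * sqrt r))"
    unfolding w'1 by (intro mult_right_mono coeff) simp
  also have "emeasure lborel (cball w (4 * sqrt r)) = ennreal (unit_ball_vol (real (2 * CARD('n))) * (4 * sqrt r) ^ (2 * CARD('n)))"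
    using s by (subst emeasure_cball) (simp_all add: mult.commute)
  also have "(4 * sqrt r) ^ (2 * CARD('n)) = 16 ^ CARD('n) * r ^ CARD('n)"
    using r by (simp add: power_mult power_mult_distrib)
  also have "ennreal (8 * sqrt r) * (ennreal (8 * sqrt r) * ennreal (unit_ball_vol (real (2 * CARD('n))) * (16 ^ CARD('n) * r ^ CARD('n))))
     = ennreal (nball_volume_const TYPE('n) * r ^ (CARD('n) + 1))"
    using r by (simp add: ennreal_mult[symmetric] nball_volume_const_def mult_ac)
  finally show ?thesis by (simp add: S_def w'_def mult_left_mono)
qed

lemma nball_volume_const_pos: "0 < nball_volume_const TYPE('n::finite)"
  by (simp add: nball_volume_const_def unit_ball_vol_pos)

text \<open>Averaging over translations of length up to \<open>r\<close> along \<open>w\<close> separates the two factors: the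
  weight is integrated along each line by \<open>radial_slice_bound\<close>, and what remains is the volume of a
  box only slightly larger than the ball. The radius must be small so that the whole ball lies where
  \<open>w\<close> points roughly outwards.\<close>

lemma weighted_small_nball_volume:
  fixes w :: "complex ^ 'n" and b r :: real
  assumes b: "-1 < b" "b \<le> 0" and r: "0 < r" "r \<le> 1 / 32" and w: "norm w < 1"
  shows "(\<integral>\<^sup>+z. ennreal (defect z powr b) * indicator (nball w r) z \<partial>lborel)
    \<le> ennreal (nball_volume_const TYPE('n) * r powr (CARD('n) + 1 + b) / (1 + b))"
proof (cases "nball w r = {}")
  case True
  then show ?thesis by simp
next
  case False
  then obtain z0 where "z0 \<in> nball w r" by auto
  then have w1: "1 - r \<le> norm w"
    using one_minus_norm_le[of z0 w] by (auto simp: nball_def)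
  have "1 / 2 \<le> (31 / 32 :: real)\<^sup>2" by (simp add: power2_eq_square)
  also have "\<dots> \<le> (norm w)\<^sup>2" using w1 r by (intro power_mono) auto
  finally have w2: "1 / 2 \<le> (norm w)\<^sup>2" .
  define A where "A = {z. \<bar>z \<bullet> w - 1\<bar> \<le> 2 * r \<and> \<bar>z \<bullet> (\<chi> j. \<i> * w $ j)\<bar> \<le> 2 * r \<and> norm (z - w) \<le> 2 * sqrt r}"
  have A[measurable]: "A \<in> sets borel" unfolding A_def by measurable
  have Re: "\<bar>z \<bullet> w - 1\<bar> < r" and Im: "\<bar>z \<bullet> (\<chi> j. \<i> * w $ j)\<bar> < r"
    and dist: "(norm (z - w))\<^sup>2 \<le> 2 * r" if "z \<in> nball w r" for z
  proof -
    have *: "norm (1 - herm z w) < r" "norm z \<le> 1" using that by (auto simp: nball_def)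
    show "\<bar>z \<bullet> w - 1\<bar> < r"
      using * abs_Re_le_cmod[of "1 - herm z w"] by (simp add: Re_herm)
    show "\<bar>z \<bullet> (\<chi> j. \<i> * w $ j)\<bar> < r"
      using * abs_Im_le_cmod[of "1 - herm z w"] by (simp add: Im_herm)
    show "(norm (z - w))\<^sup>2 \<le> 2 * r" using norm_diff_le[of z w] w * by simp
  qed
  \<comment> \<open>A translation by at most \<open>r\<close> is negligible at the Euclidean scale \<open>sqrt r\<close>.\<close>
  have r5: "r \<le> sqrt r / 5"
  proof -
    have "sqrt r \<le> sqrt ((1 / 5)\<^sup>2)" using r by (intro real_sqrt_le_mono) (simp add: power2_eq_square)
    then have "sqrt r * sqrt r \<le> sqrt r * (1 / 5)" using r by (intro mult_left_mono) auto
    then show ?thesis using r by simp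
  qed
  have inA: "z \<in> A" if t: "0 \<le> t" "t \<le> r" and z: "z + t *\<^sub>R w \<in> nball w r" for z t
  proof -
    have "norm w * norm w \<le> 1" using w by (simp add: mult_le_one)
    then have "w \<bullet> w \<le> 1" by (simp add: norm_eq_sqrt_inner)
    then have tw: "0 \<le> t * (w \<bullet> w)" "t * (w \<bullet> w) \<le> r * 1"
      using t r by (simp, intro mult_mono) auto
    have orth: "w \<bullet> (\<chi> j. \<i> * w $ j) = 0" by (rule inner_rotate)
    have "norm (z + t *\<^sub>R w - w) \<le> sqrt (2 * r)"
      using dist[OF z] by (simp add: real_le_rsqrt)
    also have "\<dots> \<le> sqrt (9 / 4 * r)" using r by (intro real_sqrt_le_mono) simp
    also have "\<dots> = 3 / 2 * sqrt r"
      by (simp add: real_sqrt_mult real_sqrt_divide)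
    finally have "norm (z + t *\<^sub>R w - w) \<le> 3 / 2 * sqrt r" .
    moreover have "norm (t *\<^sub>R w) \<le> r * 1" using t w unfolding norm_scaleR by (intro mult_mono) auto
    moreover have "norm (z - w) \<le> norm (z + t *\<^sub>R w - w) + norm (t *\<^sub>R w)"
      using norm_triangle_ineq4[of "z + t *\<^sub>R w - w" "t *\<^sub>R w"] by (simp add: algebra_simps)
    ultimately have "norm (z - w) \<le> 2 * sqrt r" using r5 real_sqrt_ge_zero[of r] r by linarith
    moreover have "\<bar>z \<bullet> w - 1\<bar> \<le> 2 * r"
      using Re[OF z] tw by (simp add: inner_add_left)
    moreover have "\<bar>z \<bullet> (\<chi> j. \<i> * w $ j)\<bar> \<le> 2 * r"
      using Im[OF z] r orth by (simp add: inner_add_left)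
    ultimately show ?thesis by (simp add: A_def)
  qed
  have "(\<integral>\<^sup>+z. ennreal (defect z powr b) * indicator (nball w r) z \<partial>lborel)
    \<le> ennreal (r powr (1 + b) / (1 + b)) / ennreal r * emeasure lborel A"
  proof (rule averaging_bound[OF _ A r(1), where u=w])
    fix z
    show "(\<integral>\<^sup>+t. ennreal (defect (z + t *\<^sub>R w) powr b) * indicator (nball w r) (z + t *\<^sub>R w) * indicator {0..r} t \<partial>lborel)
      \<le> ennreal (r powr (1 + b) / (1 + b)) * indicator A z"
    proof (cases "z \<in> A")
      case True
      have "norm x \<le> 1 \<and> 1 / 2 \<le> x \<bullet> w" if "x \<in> nball w r" for x
        using Re[OF that] that r by (auto simp: nball_def)
      then show ?thesis using radial_slice_bound[OF b r(1), of "nball w r" w z] True by simp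
    next
      case False
      then have "(\<lambda>t. ennreal (defect (z + t *\<^sub>R w) powr b) * indicator (nball w r) (z + t *\<^sub>R w) * indicator {0..r} t) = (\<lambda>t. 0)"
        using inA[of _ z] by (auto simp: indicator_def fun_eq_iff)
      then show ?thesis by simp
    qed
  qed measurable
  also have "\<dots> \<le> ennreal (r powr (1 + b) / (1 + b)) / ennreal r * ennreal (nball_volume_const TYPE('n) * r ^ (CARD('n) + 1))"
    unfolding A_def using nball_box_volume[OF r(1) w2] w by (intro mult_left_mono) auto
  also have "\<dots> = ennreal (r powr (1 + b) / (1 + b) / r * (nball_volume_const TYPE('n) * r ^ (CARD('n) + 1)))"
    using r b nball_volume_const_pos[where 'n='n] by (simp add: divide_ennreal ennreal_mult[symmetric])
  also have "r powr (1 + b) / (1 + b) / r * (nball_volume_const TYPE('n) * r ^ (CARD('n) + 1))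
     = nball_volume_const TYPE('n) * (r powr (1 + b) * r powr CARD('n)) / (1 + b)"
    using r by (simp add: powr_realpow)
  also have "\<dots> = nball_volume_const TYPE('n) * r powr (CARD('n) + 1 + b) / (1 + b)"
    by (simp add: powr_add[symmetric] add_ac)
  finally show ?thesis .
qed

text \<open>A point close to the sphere lies in the small ball centred at a slight contraction of itself;
  compactness leaves finitely many such balls.\<close>

lemma sphere_covered_by_small_nballs:
  "\<exists>W :: (complex ^ 'n) set. finite W \<and> W \<subseteq> ball 0 1 \<and>
     (\<forall>z\<in>ball 0 1. (norm z)\<^sup>2 < 63 / 64 \<or> (\<exists>w\<in>W. z \<in> nball w (1 / 32)))"
proof -
  define O' where "O' w = {z :: complex ^ 'n. norm (1 - herm z w) < 1 / 32}" for w
  define K where "K = {z :: complex ^ 'n. norm z \<le> 1 \<and> 63 / 64 \<le> (norm z)\<^sup>2}"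
  have "closed K" unfolding K_def
    by (intro closed_Collect_conj closed_Collect_le continuous_intros)
  moreover have "K \<subseteq> cball 0 1" by (auto simp: K_def)
  ultimately have "compact K" using compact_cball[of "0 :: complex ^ 'n" 1] closed_Int_compact
    by (metis Int_absorb2)
  have op: "open (O' w)" for w
    unfolding O'_def by (intro open_Collect_less continuous_intros)
  have "K \<subseteq> (\<Union>w\<in>ball 0 1. O' w)"
  proof
    fix z assume z: "z \<in> K"
    \<comment> \<open>\<open>1 - 127/128 * |z|\<^sup>2 < 1/32\<close> whenever \<open>|z|\<^sup>2 \<ge> 63/64\<close>; the factor is below \<open>1\<close> to keep \<open>w\<close> inside the ball.\<close>
    define w where "w = (127 / 128 :: real) *\<^sub>R z"
    have "norm w < 1" using z by (simp add: w_def K_def)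
    moreover have "herm z w = of_real (127 / 128 * (norm z)\<^sup>2)"
    proof -
      have "herm z w = of_real (127 / 128) * herm z z"
        unfolding herm_def w_def sum_distrib_left vector_scaleR_component
        by (intro sum.cong) (auto simp: scaleR_conv_of_real)
      then show ?thesis by (simp add: herm_self)
    qed
    then have "norm (1 - herm z w) = \<bar>1 - 127 / 128 * (norm z)\<^sup>2\<bar>"
      by (metis norm_of_real of_real_1 of_real_diff)
    moreover have "(norm z)\<^sup>2 \<le> 1" "63 / 64 \<le> (norm z)\<^sup>2" using z by (auto simp: K_def power_le_one)
    ultimately show "z \<in> (\<Union>w\<in>ball 0 1. O' w)"
      by (intro UN_I[of w]) (auto simp: O'_def)
  qed
  then obtain W where W: "W \<subseteq> ball 0 1" "finite W" "K \<subseteq> (\<Union>w\<in>W. O' w)"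
    using compactE_image[OF \<open>compact K\<close>, of "ball 0 1" O'] op by metis
  have "(norm z)\<^sup>2 < 63 / 64 \<or> (\<exists>w\<in>W. z \<in> nball w (1 / 32))" if "z \<in> ball 0 1" for z
  proof (cases "z \<in> K")
    case True
    then show ?thesis using W that by (auto simp: nball_def O'_def)
  qed (use that in \<open>auto simp: K_def\<close>)
  then show ?thesis using W by blast
qed

lemma weighted_ball_volume:
  "\<exists>C>0. \<forall>b::real. -1 < b \<longrightarrow> b \<le> 0 \<longrightarrow>
     (\<integral>\<^sup>+z. ennreal (defect z powr b) * indicator (ball 0 1) z \<partial>(lborel :: (complex ^ 'n) measure))
       \<le> ennreal (C / (1 + b))"
proof -
  obtain W :: "(complex ^ 'n) set" where W: "finite W" "W \<subseteq> ball 0 1"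
    and cover: "\<And>z. z \<in> ball 0 1 \<Longrightarrow> (norm z)\<^sup>2 < 63 / 64 \<or> (\<exists>w\<in>W. z \<in> nball w (1 / 32))"
    using sphere_covered_by_small_nballs[where 'n='n] by blast
  define v where "v = unit_ball_vol (real (2 * CARD('n)))"
  have v: "0 < v" by (simp add: v_def unit_ball_vol_pos)
  define V where "V = nball_volume_const TYPE('n)"
  have V: "0 < V" by (simp add: V_def nball_volume_const_pos)
  define C where "C = 64 * v + real (card W) * V"
  have "0 < C" using v V by (simp add: C_def add_pos_nonneg)
  moreover have "(\<integral>\<^sup>+z. ennreal (defect z powr b) * indicator (ball 0 1) z \<partial>(lborel :: (complex ^ 'n) measure))
       \<le> ennreal (C / (1 + b))" if b: "-1 < b" "b \<le> 0" for b
  proof -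
    define h :: "complex ^ 'n \<Rightarrow> ennreal" where "h = (\<lambda>z. ennreal (defect z powr b))"
    have [measurable]: "ball (0 :: complex ^ 'n) 1 \<in> sets borel" by simp
    have h[measurable]: "h \<in> borel_measurable borel" unfolding h_def by measurable
    have "(\<integral>\<^sup>+z. h z * indicator (ball 0 1) z \<partial>lborel)
      \<le> (\<integral>\<^sup>+z. 64 * indicator (ball 0 1) z + (\<Sum>w\<in>W. h z * indicator (nball w (1 / 32)) z) \<partial>lborel)"
    proof (rule nn_integral_mono)
      fix z
      show "h z * indicator (ball 0 1) z \<le> 64 * indicator (ball 0 1) z + (\<Sum>w\<in>W. h z * indicator (nball w (1 / 32)) z)"
      proof (cases "z \<in> ball 0 1")
        case True
        from cover[OF True] show ?thesis
        proof
          assume "(norm z)\<^sup>2 < 63 / 64"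
          then have "defect z powr b \<le> (1 / 64) powr b"
            using b by (intro powr_mono2') auto
          also have "\<dots> \<le> (1 / 64) powr (-1)" using b by (intro powr_mono') auto
          also have "\<dots> = 64" by (simp add: powr_minus_divide)
          finally have "h z \<le> 64" unfolding h_def by (metis ennreal_leI ennreal_numeral)
          then show ?thesis using True by (simp add: add_increasing2)
        next
          assume "\<exists>w\<in>W. z \<in> nball w (1 / 32)"
          then obtain w where w: "w \<in> W" "z \<in> nball w (1 / 32)" by blast
          have "h z = h z * indicator (nball w (1 / 32)) z" using w by simp
          also have "\<dots> \<le> (\<Sum>w\<in>W. h z * indicator (nball w (1 / 32)) z)"
            using w W by (intro member_le_sum) auto
          finally show ?thesis using True by (simp add: add_increasing)
        qed
      qed simp
    qed
    also have "\<dots> = (\<integral>\<^sup>+z. 64 * indicator (ball (0 :: complex ^ 'n) 1) z \<partial>lborel)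
        + (\<integral>\<^sup>+z. (\<Sum>w\<in>W. h z * indicator (nball w (1 / 32)) z) \<partial>lborel)"
      by (rule nn_integral_add) (auto intro!: borel_measurable_sum)
    also have "\<dots> = 64 * emeasure lborel (ball (0 :: complex ^ 'n) 1)
        + (\<Sum>w\<in>W. \<integral>\<^sup>+z. h z * indicator (nball w (1 / 32)) z \<partial>lborel)"
      by (subst nn_integral_sum) (auto simp: nn_integral_cmult_indicator)
    also have "\<dots> \<le> 64 * ennreal v + (\<Sum>w\<in>W. ennreal (V / (1 + b)))"
    proof (intro add_mono mult_left_mono sum_mono)
      show "emeasure lborel (ball (0 :: complex ^ 'n) 1) \<le> ennreal v"
        by (subst emeasure_ball) (simp_all add: v_def mult.commute)
      fix w assume "w \<in> W"
      then have "norm w < 1" using W by auto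
      then have "(\<integral>\<^sup>+z. h z * indicator (nball w (1 / 32)) z \<partial>lborel) \<le> ennreal (V * (1 / 32) powr (CARD('n) + 1 + b) / (1 + b))"
        unfolding h_def V_def using weighted_small_nball_volume[OF b, of "1/32" w] by simp
      also have "\<dots> \<le> ennreal (V * 1 / (1 + b))"
        using V b by (intro ennreal_leI divide_right_mono mult_left_mono powr_le1) auto
      finally show "(\<integral>\<^sup>+z. h z * indicator (nball w (1 / 32)) z \<partial>lborel) \<le> ennreal (V / (1 + b))" by simp
    qed simp
    also have "\<dots> = ennreal (64 * v + real (card W) * (V / (1 + b)))"
    proof -
      have "64 * ennreal v = ennreal (64 * v)" by (simp add: ennreal_mult')
      moreover have "(\<Sum>w\<in>W. ennreal (V / (1 + b))) = ennreal (real (card W) * (V / (1 + b)))"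
        using V b by (subst sum_ennreal) auto
      ultimately show ?thesis using v V b by (simp add: ennreal_plus[symmetric] del: ennreal_plus)
    qed
    also have "\<dots> \<le> ennreal (C / (1 + b))"
    proof (rule ennreal_leI)
      have "64 * v * (1 + b) \<le> 64 * v * 1" using v b by (intro mult_left_mono) auto
      then have "64 * v \<le> 64 * v / (1 + b)" using b by (subst pos_le_divide_eq) auto
      then show "64 * v + real (card W) * (V / (1 + b)) \<le> C / (1 + b)"
        by (simp add: C_def add_divide_distrib)
    qed
    finally show ?thesis by (simp add: h_def)
  qed
  ultimately show ?thesis by blast
qed

section \<open>Passing to normalized measure and arbitrary radii\<close>

lemma space_V_ball [simp]: "space V_ball = ball 0 1"
  by (simp add: V_ball_def space_restrict_space)

lemma measurable_V_ball:
  assumes "h \<in> borel_measurable borel"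
  shows "h \<in> borel_measurable V_ball"
proof -
  have "h \<in> borel_measurable (lebesgue_on (ball 0 1))"
    using assms by (intro measurable_restrict_space1 measurable_completion) simp
  then show ?thesis by (simp add: V_ball_def)
qed

lemma sets_V_ball_borel:
  assumes "A \<in> sets borel"
  shows "ball 0 1 \<inter> A \<in> sets V_ball"
  using assms by (auto simp: V_ball_def sets_restrict_space)

lemma emeasure_unit_ball:
  "emeasure lborel (ball (0 :: complex ^ 'n) 1) = ennreal (unit_ball_vol (real (2 * CARD('n))))"
  by (subst emeasure_ball) (simp_all add: mult.commute)

lemma nn_integral_V_ball:
  fixes h :: "complex ^ 'n \<Rightarrow> ennreal"
  assumes h[measurable]: "h \<in> borel_measurable borel"
  shows "(\<integral>\<^sup>+z. h z \<partial>V_ball)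
    = (\<integral>\<^sup>+z. h z * indicator (ball 0 1) z \<partial>lborel) / ennreal (unit_ball_vol (real (2 * CARD('n))))"
proof -
  let ?L = "lebesgue_on (ball (0 :: complex ^ 'n) 1)"
  have m: "h \<in> borel_measurable ?L"
    by (intro measurable_restrict_space1 measurable_completion) simp
  have b: "ball 0 1 \<in> sets ?L" by (simp add: sets_restrict_space_iff)
  have e: "emeasure ?L (ball 0 1) = ennreal (unit_ball_vol (real (2 * CARD('n))))"
    by (subst emeasure_restrict_space) (simp_all add: emeasure_unit_ball)
  have i: "(\<integral>\<^sup>+z\<in>ball 0 1. h z \<partial>?L) = (\<integral>\<^sup>+z. h z * indicator (ball 0 1) z \<partial>lborel)"
    by (subst nn_integral_restrict_space)
       (auto simp: nn_integral_completion indicator_def intro!: nn_integral_cong)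
  show ?thesis
    unfolding V_ball_def using m b by (subst nn_integral_uniform_measure) (simp_all add: e i)
qed

lemma sigma_finite_V_ball: "sigma_finite_measure (V_ball :: (complex ^ 'n) measure)"
proof -
  have "emeasure (V_ball :: (complex ^ 'n) measure) (space V_ball) = (\<integral>\<^sup>+z. 1 \<partial>(V_ball :: (complex ^ 'n) measure))"
    by simp
  also have "\<dots> < \<infinity>"
    by (subst nn_integral_V_ball)
       (auto simp: emeasure_unit_ball divide_ennreal unit_ball_vol_pos less_imp_le)
  finally have "finite_measure (V_ball :: (complex ^ 'n) measure)"
    by (intro finite_measureI) auto
  then show ?thesis by (rule finite_measure.axioms)
qed

text \<open>For radii beyond \<open>1 / 32\<close> the bound for the whole ball suffices, because the right-hand side is
  then bounded below. It is convenient to allow all radii, as radii up to \<open>12 * 2 ^ m\<close> occur.\<close>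

lemma weighted_nball_volume:
  "\<exists>C>0. \<forall>(b::real) r. \<forall>w :: complex ^ 'n. -1 < b \<longrightarrow> b \<le> 0 \<longrightarrow> 0 < r \<longrightarrow> norm w < 1 \<longrightarrow>
     (\<integral>\<^sup>+z. ennreal (defect z powr b) * indicator (nball w r) z \<partial>V_ball)
       \<le> ennreal (C * r powr (CARD('n) + 1 + b) / (1 + b))"
proof -
  obtain C0 where C0: "0 < C0" and whole: "\<And>b::real. -1 < b \<Longrightarrow> b \<le> 0 \<Longrightarrow>
     (\<integral>\<^sup>+z. ennreal ((1 - (norm z)\<^sup>2) powr b) * indicator (ball 0 1) z \<partial>(lborel :: (complex ^ 'n) measure))
       \<le> ennreal (C0 / (1 + b))"
    using weighted_ball_volume[where 'n='n] by blast
  define v where "v = unit_ball_vol (real (2 * CARD('n)))"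
  have v: "0 < v" by (simp add: v_def unit_ball_vol_pos)
  define V where "V = nball_volume_const TYPE('n)"
  have V: "0 < V" by (simp add: V_def nball_volume_const_pos)
  define C1 where "C1 = V + C0 * 32 ^ (CARD('n) + 1)"
  have C1: "0 < C1" using V C0 by (simp add: C1_def add_pos_pos)
  have "(\<integral>\<^sup>+z. ennreal (defect z powr b) * indicator (nball w r) z \<partial>V_ball)
       \<le> ennreal (C1 / v * r powr (CARD('n) + 1 + b) / (1 + b))"
    if b: "-1 < b" "b \<le> 0" and r: "0 < r" and w: "norm w < 1" for b r :: real and w :: "complex ^ 'n"
  proof -
    have "(\<integral>\<^sup>+z. ennreal (defect z powr b) * indicator (nball w r) z \<partial>lborel)
      \<le> ennreal (C1 * r powr (CARD('n) + 1 + b) / (1 + b))"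
    proof (cases "r \<le> 1 / 32")
      case True
      have "V * r powr (CARD('n) + 1 + b) / (1 + b) \<le> C1 * r powr (CARD('n) + 1 + b) / (1 + b)"
        using b C0 by (intro divide_right_mono mult_right_mono) (auto simp: C1_def)
      then show ?thesis
        using weighted_small_nball_volume[OF b r True w, folded V_def] by (meson ennreal_leI order_trans)
    next
      case False
      have "(1 / 32) powr (CARD('n) + 1) \<le> (1 / 32 :: real) powr (CARD('n) + 1 + b)"
        using b by (intro powr_mono') auto
      also have "\<dots> \<le> r powr (CARD('n) + 1 + b)"
        using b False by (intro powr_mono2) auto
      also have "(1 / 32 :: real) powr (CARD('n) + 1) = 1 / 32 ^ (CARD('n) + 1)"
        using powr_realpow[of "1 / 32 :: real" "CARD('n) + 1"] by (simp add: power_divide add.commute)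
      finally have "1 \<le> 32 ^ (CARD('n) + 1) * r powr (CARD('n) + 1 + b)"
        by (simp add: field_simps)
      then have "C0 * 1 \<le> C0 * (32 ^ (CARD('n) + 1) * r powr (CARD('n) + 1 + b))"
        using C0 by (intro mult_left_mono) auto
      also have "\<dots> \<le> C1 * r powr (CARD('n) + 1 + b)"
        using V by (simp add: C1_def algebra_simps)
      finally have "C0 / (1 + b) \<le> C1 * r powr (CARD('n) + 1 + b) / (1 + b)"
        using b by (intro divide_right_mono) auto
      moreover have "(\<integral>\<^sup>+z. ennreal (defect z powr b) * indicator (nball w r) z \<partial>lborel)
          \<le> (\<integral>\<^sup>+z. ennreal (defect z powr b) * indicator (ball 0 1) z \<partial>(lborel :: (complex ^ 'n) measure))"
        by (intro nn_integral_mono mult_left_mono) (auto simp: nball_def indicator_def)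
      ultimately show ?thesis
        using whole[OF b] by (meson ennreal_leI order_trans)
    qed
    moreover have "(\<integral>\<^sup>+z. ennreal (defect z powr b) * indicator (nball w r) z \<partial>V_ball)
      = (\<integral>\<^sup>+z. ennreal (defect z powr b) * indicator (nball w r) z \<partial>lborel) / ennreal v"
      by (subst nn_integral_V_ball, measurable)
         (auto simp: v_def nball_def indicator_def intro!: arg_cong2[where f=divide] nn_integral_cong)
    ultimately have "(\<integral>\<^sup>+z. ennreal (defect z powr b) * indicator (nball w r) z \<partial>V_ball)
      \<le> ennreal (C1 * r powr (CARD('n) + 1 + b) / (1 + b)) / ennreal v"
      by (simp add: divide_right_mono_ennreal)
    also have "\<dots> = ennreal (C1 / v * r powr (CARD('n) + 1 + b) / (1 + b))"
      using v b C1 by (simp add: divide_ennreal field_simps)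
    finally show ?thesis .
  qed
  moreover have "0 < C1 / v" using C1 v by simp
  ultimately show ?thesis by blast
qed

section \<open>Dyadic decomposition of the kernel\<close>

definition abs_kernel :: "complex ^ 'n \<Rightarrow> complex ^ 'n \<Rightarrow> real" where
  "abs_kernel z w = 1 / norm (1 - herm z w) ^ (CARD('n) + 1)"

lemma abs_kernel_commute: "abs_kernel z w = abs_kernel w z"
  by (simp add: abs_kernel_def norm_one_minus_herm_commute[of z w])

lemma defect_pos: "norm z < 1 \<Longrightarrow> 0 < defect z"
  by (simp add: power_less_one_iff abs_square_less_1)

text \<open>Since \<open>|1 - \<langle>z,w\<rangle>| \<ge> defect z / 2\<close>, each \<open>w\<close> has a smallest \<open>m\<close> with
  \<open>w \<in> nball z (2 ^ m * defect z)\<close>, and for this \<open>m\<close> the radius is at most \<open>2 * |1 - \<langle>z,w\<rangle>|\<close>.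
  Measuring the scales relative to \<open>defect z\<close> makes the decay in \<open>m\<close> the same for every \<open>z\<close>.\<close>

lemma abs_kernel_dyadic:
  fixes z :: "complex ^ 'n"
  assumes g: "g \<in> borel_measurable V_ball" and z: "norm z < 1"
  shows "(\<integral>\<^sup>+w. g w * ennreal (abs_kernel z w) \<partial>V_ball)
    \<le> (\<Sum>m. ennreal ((2 / (2 ^ m * defect z)) ^ (CARD('n) + 1)) *
          (\<integral>\<^sup>+w. g w * indicator (nball z (2 ^ m * defect z)) w \<partial>V_ball))"
proof -
  note g[measurable]
  have [measurable]: "(\<lambda>w. indicator (nball z r) w :: ennreal) \<in> borel_measurable V_ball" for r
    by (intro measurable_V_ball) measurable
  let ?c = "\<lambda>m. ennreal ((2 / (2 ^ m * defect z)) ^ (CARD('n) + 1))"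
  let ?i = "\<lambda>m w. indicator (nball z (2 ^ m * defect z)) w :: ennreal"
  note d = defect_pos[OF z]
  have "(\<integral>\<^sup>+w. g w * ennreal (abs_kernel z w) \<partial>V_ball)
    \<le> (\<integral>\<^sup>+w. (\<Sum>m. ?c m * (g w * ?i m w)) \<partial>V_ball)"
  proof (rule nn_integral_mono)
    fix w assume "w \<in> space (V_ball :: (complex ^ 'n) measure)"
    then have w: "norm w < 1" by simp
    define D where "D = norm (1 - herm z w)"
    have lower: "defect z \<le> 2 * D"
      using defect_le[of w z] w z by (simp add: D_def norm_one_minus_herm_commute[of w z])
    have "\<exists>m. D < 2 ^ m * defect z"
      using real_arch_pow[of 2 "D / defect z"] d by (simp add: field_simps)
    then obtain m where m: "D < 2 ^ m * defect z" and least: "\<And>k. k < m \<Longrightarrow> \<not> D < 2 ^ k * defect z"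
      using exists_least_iff[of "\<lambda>m. D < 2 ^ m * defect z"] by blast
    have "2 ^ m * defect z \<le> 2 * D"
      using lower least[of "m - 1"] by (cases m) auto
    then have "1 / D \<le> 2 / (2 ^ m * defect z)"
      using d lower by (simp add: field_simps)
    moreover have "0 < D" using d lower by simp
    ultimately have "(1 / D) ^ (CARD('n) + 1) \<le> (2 / (2 ^ m * defect z)) ^ (CARD('n) + 1)"
      by (intro power_mono) auto
    then have "ennreal (abs_kernel z w) \<le> ?c m"
      unfolding abs_kernel_def D_def power_one_over by (rule ennreal_leI)
    then have "g w * ennreal (abs_kernel z w) \<le> ?c m * (g w * ?i m w)"
      using m w by (simp add: nball_def D_def norm_one_minus_herm_commute[of w z] mult.commute mult_left_mono)
    also have "\<dots> \<le> (\<Sum>m. ?c m * (g w * ?i m w))"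
      using sum_le_suminf[of "\<lambda>m. ?c m * (g w * ?i m w)" "{m}"] by simp
    finally show "g w * ennreal (abs_kernel z w) \<le> (\<Sum>m. ?c m * (g w * ?i m w))" .
  qed
  also have "\<dots> = (\<Sum>m. \<integral>\<^sup>+w. ?c m * (g w * ?i m w) \<partial>V_ball)"
    by (rule nn_integral_suminf) measurable
  also have "\<dots> = (\<Sum>m. ?c m * (\<integral>\<^sup>+w. g w * ?i m w \<partial>V_ball))"
    by (subst nn_integral_cmult) auto
  finally show ?thesis .
qed

lemma suminf_geometric_ennreal:
  fixes c p :: real
  assumes "0 \<le> c" "0 \<le> p" "p < 1"
  shows "(\<Sum>m. ennreal (c * p ^ m)) = ennreal (c / (1 - p))"
  using sums_mult[OF geometric_sums[of p], of c] assms
  by (intro suminf_ennreal_eq) auto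

section \<open>Exponents at most -1/2: a strong bound\<close>

text \<open>The ball of radius \<open>R = 2 ^ m * defect w\<close> contributes \<open>R powr b\<close> up to constants. For
  \<open>b \<le> -1/2\<close> this decays geometrically in \<open>m\<close> at a rate independent of \<open>b\<close>, so that
  \<open>1 / (1 + b)\<close> is the only loss.\<close>

lemma abs_kernel_Schur_bound:
  "\<exists>C>0. \<forall>b::real. \<forall>w :: complex ^ 'n. -1 < b \<longrightarrow> b \<le> -1/2 \<longrightarrow> norm w < 1 \<longrightarrow>
     (\<integral>\<^sup>+z. ennreal (defect z powr b) * ennreal (abs_kernel z w) \<partial>V_ball)
       \<le> ennreal (C / (1 + b) * defect w powr b)"
proof -
  obtain C where C: "0 < C" and vol: "\<And>(b::real) r (w :: complex ^ 'n). -1 < b \<Longrightarrow> b \<le> 0 \<Longrightarrow> 0 < r \<Longrightarrow> norm w < 1 \<Longrightarrow>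
     (\<integral>\<^sup>+z. ennreal (defect z powr b) * indicator (nball w r) z \<partial>V_ball)
       \<le> ennreal (C * r powr (CARD('n) + 1 + b) / (1 + b))"
    using weighted_nball_volume[where 'n='n] by blast
  define p :: real where "p = 2 powr (-1/2)"
  have p: "0 < p" "p < 1" using powr_less_mono[of "-1/2" 0 "2::real"] by (auto simp: p_def)
  define C' where "C' = 2 ^ (CARD('n) + 1) * C / (1 - p)"
  have "(\<integral>\<^sup>+z. ennreal (defect z powr b) * ennreal (abs_kernel z w) \<partial>V_ball)
       \<le> ennreal (C' / (1 + b) * defect w powr b)"
    if b: "-1 < b" "b \<le> -1/2" and w: "norm w < 1" for b and w :: "complex ^ 'n"
  proof -
    define d where "d = defect w"
    have d: "0 < d" using defect_pos[OF w] by (simp add: d_def)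
    have "(\<integral>\<^sup>+z. ennreal (defect z powr b) * ennreal (abs_kernel z w) \<partial>V_ball)
      = (\<integral>\<^sup>+z. ennreal (defect z powr b) * ennreal (abs_kernel w z) \<partial>V_ball)"
      by (simp add: abs_kernel_commute)
    also have "\<dots> \<le> (\<Sum>m. ennreal ((2 / (2 ^ m * defect w)) ^ (CARD('n) + 1)) *
          (\<integral>\<^sup>+z. ennreal (defect z powr b) * indicator (nball w (2 ^ m * defect w)) z \<partial>V_ball))"
      by (intro abs_kernel_dyadic w measurable_V_ball) measurable
    also have "\<dots> \<le> (\<Sum>m. ennreal (2 ^ (CARD('n) + 1) * C / (1 + b) * d powr b * p ^ m))"
    proof (intro suminf_le summableI)
      fix m
      define R where "R = 2 ^ m * d"
      have R: "0 < R" using d by (simp add: R_def)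
      have "(\<integral>\<^sup>+z. ennreal (defect z powr b) * indicator (nball w R) z \<partial>V_ball)
         \<le> ennreal (C * R powr (CARD('n) + 1 + b) / (1 + b))"
        using b w R by (intro vol) auto
      then have "ennreal ((2 / R) ^ (CARD('n) + 1)) * (\<integral>\<^sup>+z. ennreal (defect z powr b) * indicator (nball w R) z \<partial>V_ball)
         \<le> ennreal ((2 / R) ^ (CARD('n) + 1)) * ennreal (C * R powr (CARD('n) + 1 + b) / (1 + b))"
        by (intro mult_left_mono) auto
      also have "\<dots> = ennreal ((2 / R) ^ (CARD('n) + 1) * (C * R powr (CARD('n) + 1 + b) / (1 + b)))"
        using R C b by (subst ennreal_mult) auto
      also have "\<dots> \<le> ennreal (2 ^ (CARD('n) + 1) * C / (1 + b) * d powr b * p ^ m)"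
      proof (rule ennreal_leI)
        have "R powr (CARD('n) + 1 + b) = R ^ (CARD('n) + 1) * R powr b"
          using R powr_realpow[of R "CARD('n) + 1"] by (simp add: powr_add)
        then have "(2 / R) ^ (CARD('n) + 1) * (C * R powr (CARD('n) + 1 + b) / (1 + b))
          = (2 / R * R) ^ (CARD('n) + 1) * C / (1 + b) * R powr b"
          unfolding power_mult_distrib by simp
        also have "\<dots> = 2 ^ (CARD('n) + 1) * C / (1 + b) * R powr b"
          using R by simp
        also have "R powr b = d powr b * (2 powr b) ^ m"
          using d by (simp add: R_def powr_mult powr_realpow[symmetric] powr_powr mult.commute)
        also have "2 ^ (CARD('n) + 1) * C / (1 + b) * (d powr b * (2 powr b) ^ m)
          \<le> 2 ^ (CARD('n) + 1) * C / (1 + b) * (d powr b * p ^ m)"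
          using b C unfolding p_def by (intro mult_left_mono power_mono powr_mono) auto
        finally show "(2 / R) ^ (CARD('n) + 1) * (C * R powr (CARD('n) + 1 + b) / (1 + b))
          \<le> 2 ^ (CARD('n) + 1) * C / (1 + b) * d powr b * p ^ m" by (simp add: mult.assoc)
      qed
      finally show "ennreal ((2 / (2 ^ m * defect w)) ^ (CARD('n) + 1)) *
          (\<integral>\<^sup>+z. ennreal (defect z powr b) * indicator (nball w (2 ^ m * defect w)) z \<partial>V_ball)
        \<le> ennreal (2 ^ (CARD('n) + 1) * C / (1 + b) * d powr b * p ^ m)"
        by (simp add: R_def d_def)
    qed
    also have "\<dots> = ennreal (2 ^ (CARD('n) + 1) * C / (1 + b) * d powr b / (1 - p))"
      using C b p by (intro suminf_geometric_ennreal) auto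
    also have "\<dots> = ennreal (C' / (1 + b) * defect w powr b)"
      by (simp add: C'_def d_def mult.commute)
    finally show ?thesis .
  qed
  moreover have "0 < C'" using C p by (simp add: C'_def)
  ultimately show ?thesis by blast
qed

lemma borel_measurable_abs_kernel_pair:
  "(\<lambda>(z, w). ennreal (abs_kernel z w)) \<in> borel_measurable (V_ball \<Otimes>\<^sub>M (V_ball :: (complex ^ 'n) measure))"
proof -
  have "continuous_on UNIV (\<lambda>x :: (complex ^ 'n) \<times> (complex ^ 'n). norm (1 - herm (fst x) (snd x)))"
    by (intro continuous_intros)
  then have "(\<lambda>x :: (complex ^ 'n) \<times> (complex ^ 'n). norm (1 - herm (fst x) (snd x))) \<in> borel_measurable borel"
    by (rule borel_measurable_continuous_onI)
  then have [measurable]: "(\<lambda>x. ennreal (abs_kernel (fst x) (snd x))) \<in> borel_measurable (borel \<Otimes>\<^sub>M (borel :: (complex ^ 'n) measure))"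
    unfolding abs_kernel_def borel_prod by measurable
  have id: "(\<lambda>x. x) \<in> measurable (V_ball :: (complex ^ 'n) measure) borel"
    by (rule measurable_V_ball) simp
  have 1: "(\<lambda>x. fst x) \<in> measurable (V_ball \<Otimes>\<^sub>M (V_ball :: (complex ^ 'n) measure)) (borel :: (complex ^ 'n) measure)"
    using measurable_compose[OF measurable_fst[of V_ball "V_ball :: (complex ^ 'n) measure"] id] by simp
  have 2: "(\<lambda>x. snd x) \<in> measurable ((V_ball :: (complex ^ 'n) measure) \<Otimes>\<^sub>M (V_ball :: (complex ^ 'n) measure)) (borel :: (complex ^ 'n) measure)"
    using measurable_compose[OF measurable_snd[of "V_ball :: (complex ^ 'n) measure" V_ball] id] by simp
  have [measurable]: "(\<lambda>x. (fst x, snd x)) \<in> measurable ((V_ball :: (complex ^ 'n) measure) \<Otimes>\<^sub>M (V_ball :: (complex ^ 'n) measure)) ((borel :: (complex ^ 'n) measure) \<Otimes>\<^sub>M (borel :: (complex ^ 'n) measure))"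
    by (intro measurable_Pair 1 2)
  have "(\<lambda>x. ennreal (abs_kernel (fst (fst x, snd x)) (snd (fst x, snd x)))) \<in> borel_measurable (V_ball \<Otimes>\<^sub>M (V_ball :: (complex ^ 'n) measure))"
    by (rule measurable_compose[where N="borel \<Otimes>\<^sub>M borel" and f="\<lambda>x. (fst x, snd x)"]) measurable
  then show ?thesis by (simp add: case_prod_beta')
qed

text \<open>As a nonnegative integral this is meaningful, possibly infinite, for every measurable \<open>g\<close>, and
  Fubini's theorem applies to it directly.\<close>

definition abs_proj :: "(complex ^ 'n \<Rightarrow> ennreal) \<Rightarrow> complex ^ 'n \<Rightarrow> ennreal" where
  "abs_proj g z = (\<integral>\<^sup>+w. g w * ennreal (abs_kernel z w) \<partial>V_ball)"

text \<open>Fubini's theorem and the Schur bound give a strong \<open>L\<^sup>1\<close> estimate, and Markov's inequality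
  weakens it. Here \<open>S\<close> is the level set itself; in the covering argument for the other
  exponents it is a union of balls.\<close>

lemma weak_type_strong_range:
  "\<exists>C>0. \<forall>(b::real) g. \<forall>t>0. -1 < b \<longrightarrow> b \<le> -1/2 \<longrightarrow> g \<in> borel_measurable (V_ball :: (complex ^ 'n) measure) \<longrightarrow>
     (\<exists>S\<in>sets V_ball. {z \<in> ball 0 1. ennreal t < abs_proj g z} \<subseteq> S \<and>
        ennreal t * (\<integral>\<^sup>+z. ennreal (defect z powr b) * indicator S z \<partial>V_ball)
          \<le> ennreal (C / (1 + b)) * (\<integral>\<^sup>+w. g w * ennreal (defect w powr b) \<partial>V_ball))"
proof -
  obtain C where C: "0 < C" and schur: "\<And>(b::real) (w :: complex ^ 'n). -1 < b \<Longrightarrow> b \<le> -1/2 \<Longrightarrow> norm w < 1 \<Longrightarrow>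
     (\<integral>\<^sup>+z. ennreal (defect z powr b) * ennreal (abs_kernel z w) \<partial>V_ball)
       \<le> ennreal (C / (1 + b) * defect w powr b)"
    using abs_kernel_Schur_bound[where 'n='n] by blast
  let ?V = "V_ball :: (complex ^ 'n) measure"
  interpret V: sigma_finite_measure ?V by (rule sigma_finite_V_ball)
  interpret VV: pair_sigma_finite ?V ?V ..
  note borel_measurable_abs_kernel_pair[measurable]
  have "\<exists>S\<in>sets ?V. {z \<in> ball 0 1. ennreal t < abs_proj g z} \<subseteq> S \<and>
        ennreal t * (\<integral>\<^sup>+z. ennreal (defect z powr b) * indicator S z \<partial>?V)
          \<le> ennreal (C / (1 + b)) * (\<integral>\<^sup>+w. g w * ennreal (defect w powr b) \<partial>?V)"
    if t: "0 < t" and b: "-1 < b" "b \<le> -1/2" and g[measurable]: "g \<in> borel_measurable ?V" for b t :: real and g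
  proof -
    have [measurable]: "(\<lambda>z. ennreal (defect z powr b)) \<in> borel_measurable ?V"
      by (intro measurable_V_ball) measurable
    have T[measurable]: "abs_proj g \<in> borel_measurable ?V"
      unfolding abs_proj_def by measurable
    define S where "S = {z \<in> space ?V. ennreal t < abs_proj g z}"
    have S[measurable]: "S \<in> sets ?V" unfolding S_def by measurable
    have "ennreal t * (\<integral>\<^sup>+z. ennreal (defect z powr b) * indicator S z \<partial>?V)
      = (\<integral>\<^sup>+z. ennreal t * (ennreal (defect z powr b) * indicator S z) \<partial>?V)"
      by (subst nn_integral_cmult) auto
    also have "\<dots> \<le> (\<integral>\<^sup>+z. ennreal (defect z powr b) * abs_proj g z \<partial>?V)"
    proof (rule nn_integral_mono)
      fix z
      show "ennreal t * (ennreal (defect z powr b) * indicator S z) \<le> ennreal (defect z powr b) * abs_proj g z"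
      proof (cases "z \<in> S")
        case True
        then have "ennreal t \<le> abs_proj g z" by (simp add: S_def less_imp_le)
        then show ?thesis using True by (simp add: mult.commute mult_right_mono)
      qed simp
    qed
    also have "\<dots> = (\<integral>\<^sup>+z. (\<integral>\<^sup>+w. ennreal (defect z powr b) * (g w * ennreal (abs_kernel z w)) \<partial>?V) \<partial>?V)"
      unfolding abs_proj_def by (intro nn_integral_cong, subst nn_integral_cmult) auto
    also have "\<dots> = (\<integral>\<^sup>+w. (\<integral>\<^sup>+z. ennreal (defect z powr b) * (g w * ennreal (abs_kernel z w)) \<partial>?V) \<partial>?V)"
      by (rule VV.Fubini'[symmetric]) measurable
    also have "\<dots> = (\<integral>\<^sup>+w. g w * (\<integral>\<^sup>+z. ennreal (defect z powr b) * ennreal (abs_kernel z w) \<partial>?V) \<partial>?V)"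
      by (intro nn_integral_cong, subst nn_integral_cmult[symmetric]) (auto simp: mult_ac)
    also have "\<dots> \<le> (\<integral>\<^sup>+w. ennreal (C / (1 + b)) * (g w * ennreal (defect w powr b)) \<partial>?V)"
    proof (rule nn_integral_mono)
      fix w assume "w \<in> space ?V"
      then have "(\<integral>\<^sup>+z. ennreal (defect z powr b) * ennreal (abs_kernel z w) \<partial>?V)
          \<le> ennreal (C / (1 + b) * defect w powr b)"
        by (intro schur b) simp
      also have "\<dots> = ennreal (C / (1 + b)) * ennreal (defect w powr b)"
        using C b by (intro ennreal_mult) auto
      finally have "g w * (\<integral>\<^sup>+z. ennreal (defect z powr b) * ennreal (abs_kernel z w) \<partial>?V)
        \<le> g w * (ennreal (C / (1 + b)) * ennreal (defect w powr b))" by (rule mult_left_mono) simp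
      then show "g w * (\<integral>\<^sup>+z. ennreal (defect z powr b) * ennreal (abs_kernel z w) \<partial>?V)
        \<le> ennreal (C / (1 + b)) * (g w * ennreal (defect w powr b))" by (simp add: mult_ac)
    qed
    also have "\<dots> = ennreal (C / (1 + b)) * (\<integral>\<^sup>+w. g w * ennreal (defect w powr b) \<partial>?V)"
      by (subst nn_integral_cmult) auto
    finally show ?thesis using S by (intro bexI[of _ S]) (auto simp: S_def)
  qed
  then show ?thesis using C by blast
qed

section \<open>Exponents at least -1/2: the covering argument\<close>

text \<open>The constant is \<open>4 * (2 + 1)\<close>, from the quasi-triangle inequality and \<open>r \<le> 2 s\<close>.\<close>

lemma nball_subset_nball:
  assumes "u \<in> nball x r" "u \<in> nball y s" "r \<le> 2 * s" "norm x < 1" "norm y < 1"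
  shows "x \<in> nball y (12 * s)"
proof -
  have "norm (1 - herm x y) \<le> 4 * (norm (1 - herm x u) + norm (1 - herm u y))"
    using assms by (intro herm_quasi_triangle) (auto simp: nball_def)
  moreover have "norm (1 - herm x u) < r" "norm (1 - herm u y) < s"
    using assms norm_one_minus_herm_commute[of x u] by (auto simp: nball_def)
  ultimately show ?thesis using assms by (auto simp: nball_def)
qed

lemma defect_less_of_nball:
  assumes "x \<in> nball y r" "norm y < 1"
  shows "defect x < 2 * r"
  using defect_le[of y x] assms norm_one_minus_herm_commute[of x y] by (auto simp: nball_def)

text \<open>The points \<open>z\<close> whose ball of radius \<open>2 ^ m * defect z\<close> has large \<open>g\<close>-mass are covered by the
  twelvefold enlargements of disjoint balls. A point \<open>z\<close> attached to a selected ball of radius \<open>r\<close>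
  satisfies in addition \<open>defect z \<le> 2 * r / 2 ^ m\<close>; there \<open>defect z powr b\<close> is at most
  \<open>(2 * r / 2 ^ m) powr (1/4)\<close> times \<open>defect z powr (b - 1/4)\<close>, a weight whose exponent is at
  least \<open>-3/4\<close>. This gives the decay \<open>2 powr (-m/4)\<close>, with constants independent of \<open>b\<close>. On a
  selected ball the defect is less than \<open>2 r\<close>, so \<open>r powr b\<close> is at most \<open>2 * defect powr b\<close>, and
  the disjoint \<open>g\<close>-masses add up to the weighted norm of \<open>g\<close>.\<close>

lemma Vitali_level_bound:
  "\<exists>C>0. \<forall>(b::real) g lev m. -1/2 \<le> b \<longrightarrow> b \<le> 0 \<longrightarrow> 0 < lev \<longrightarrow> g \<in> borel_measurable (V_ball :: (complex ^ 'n) measure) \<longrightarrow>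
     (\<exists>S\<in>sets V_ball.
        {z \<in> ball 0 1. ennreal (lev * (2 ^ m * defect z) ^ (CARD('n) + 1)) < (\<integral>\<^sup>+w. g w * indicator (nball z (2 ^ m * defect z)) w \<partial>V_ball)} \<subseteq> S \<and>
        (\<integral>\<^sup>+z. ennreal (defect z powr b) * indicator S z \<partial>V_ball)
          \<le> ennreal (C * (2 powr (-1/4)) ^ m / lev) * (\<integral>\<^sup>+w. g w * ennreal (defect w powr b) \<partial>V_ball))"
proof -
  let ?V = "V_ball :: (complex ^ 'n) measure"
  obtain C where C: "0 < C" and vol: "\<And>(b::real) r (w :: complex ^ 'n). -1 < b \<Longrightarrow> b \<le> 0 \<Longrightarrow> 0 < r \<Longrightarrow> norm w < 1 \<Longrightarrow>
     (\<integral>\<^sup>+z. ennreal (defect z powr b) * indicator (nball w r) z \<partial>V_ball)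
       \<le> ennreal (C * r powr (real (CARD('n) + 1) + b) / (1 + b))"
    using weighted_nball_volume[where 'n='n] by blast
  define q :: real where "q = 2 powr (-1/4)"
  have q: "0 < q" by (simp add: q_def)
  define C1 where "C1 = 2 powr (1/4) * (C * 12 ^ (CARD('n) + 1) * 4)"
  have C1: "0 < C1" using C by (simp add: C1_def)
  \<comment> \<open>In the boundary layer a quarter power of the defect is traded for the decay in \<open>m\<close>.\<close>
  have cap: "(\<integral>\<^sup>+z. ennreal (defect z powr b) * indicator (nball y (12 * r) \<inter> {z. defect z \<le> 2 * r / 2 ^ m}) z \<partial>?V)
      \<le> ennreal (C1 * q ^ m * r powr (real (CARD('n) + 1) + b))"
    if b: "-1/2 \<le> b" "b \<le> 0" and r: "0 < r" and y: "norm y < 1" for b r m and y :: "complex ^ 'n"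
  proof -
    have "(\<integral>\<^sup>+z. ennreal (defect z powr b) * indicator (nball y (12 * r) \<inter> {z. defect z \<le> 2 * r / 2 ^ m}) z \<partial>?V)
      \<le> (\<integral>\<^sup>+z. ennreal ((2 * r / 2 ^ m) powr (1/4)) * (ennreal (defect z powr (b - 1/4)) * indicator (nball y (12 * r)) z) \<partial>?V)"
    proof (rule nn_integral_mono)
      fix z assume "z \<in> space ?V"
      then have d: "0 < defect z" by (intro defect_pos) simp
      show "ennreal (defect z powr b) * indicator (nball y (12 * r) \<inter> {z. defect z \<le> 2 * r / 2 ^ m}) z
        \<le> ennreal ((2 * r / 2 ^ m) powr (1/4)) * (ennreal (defect z powr (b - 1/4)) * indicator (nball y (12 * r)) z)"
      proof (cases "z \<in> nball y (12 * r) \<and> defect z \<le> 2 * r / 2 ^ m")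
        case True
        have "defect z powr b = defect z powr (1/4) * defect z powr (b - 1/4)"
          by (simp add: powr_add[symmetric])
        also have "\<dots> \<le> (2 * r / 2 ^ m) powr (1/4) * defect z powr (b - 1/4)"
          using True d by (intro mult_right_mono powr_mono2) auto
        finally show ?thesis using True by (simp add: ennreal_mult[symmetric] ennreal_leI)
      qed auto
    qed
    also have "\<dots> = ennreal ((2 * r / 2 ^ m) powr (1/4)) * (\<integral>\<^sup>+z. ennreal (defect z powr (b - 1/4)) * indicator (nball y (12 * r)) z \<partial>?V)"
      by (intro nn_integral_cmult measurable_V_ball) measurable
    also have "\<dots> \<le> ennreal ((2 * r / 2 ^ m) powr (1/4)) * ennreal (C * (12 * r) powr (real (CARD('n) + 1) + (b - 1/4)) / (1 + (b - 1/4)))"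
      using b r y by (intro mult_left_mono vol) auto
    also have "\<dots> = ennreal ((2 * r / 2 ^ m) powr (1/4) * (C * (12 * r) powr (real (CARD('n) + 1) + (b - 1/4)) / (1 + (b - 1/4))))"
      using b C by (subst ennreal_mult) auto
    also have "\<dots> \<le> ennreal (C1 * q ^ m * r powr (real (CARD('n) + 1) + b))"
    proof (rule ennreal_leI)
      define k where "k = real (CARD('n) + 1)"
      have 1: "(2 * r / 2 ^ m) powr (1/4) = 2 powr (1/4) * r powr (1/4) * q ^ m"
      proof -
        have "(2 ^ m) powr (1/4) * q ^ m = (1 :: real)"
          by (simp add: q_def powr_realpow[symmetric] powr_powr powr_add[symmetric])
        then show ?thesis using r by (simp add: powr_mult powr_divide field_simps)
      qed
      have "(12 * r) powr (k + (b - 1/4)) = 12 powr (k + (b - 1/4)) * r powr (k + (b - 1/4))"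
        using r by (simp add: powr_mult)
      also have "\<dots> \<le> 12 powr k * r powr (k + (b - 1/4))"
        using b by (intro mult_right_mono powr_mono) auto
      finally have "C * (12 * r) powr (k + (b - 1/4)) / (1 + (b - 1/4)) \<le> C * (12 powr k * r powr (k + (b - 1/4))) / (1/4)"
        using C b by (intro frac_le mult_left_mono) auto
      then have "(2 * r / 2 ^ m) powr (1/4) * (C * (12 * r) powr (k + (b - 1/4)) / (1 + (b - 1/4)))
        \<le> (2 powr (1/4) * r powr (1/4) * q ^ m) * (C * (12 powr k * r powr (k + (b - 1/4))) / (1/4))"
        unfolding 1 using q by (intro mult_left_mono) auto
      also have "\<dots> = 2 powr (1/4) * (C * 12 powr k * 4) * q ^ m * (r powr (1/4) * r powr (k + (b - 1/4)))"
        by simp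
      also have "r powr (1/4) * r powr (k + (b - 1/4)) = r powr (k + b)"
        by (simp add: powr_add[symmetric])
      also have "12 powr k = 12 ^ (CARD('n) + 1)"
        unfolding k_def by (rule powr_realpow) simp
      finally show "(2 * r / 2 ^ m) powr (1/4) * (C * (12 * r) powr (real (CARD('n) + 1) + (b - 1/4)) / (1 + (b - 1/4)))
        \<le> C1 * q ^ m * r powr (real (CARD('n) + 1) + b)"
        by (simp add: C1_def k_def)
    qed
    finally show ?thesis .
  qed
  have "\<exists>S\<in>sets ?V.
        {z \<in> ball 0 1. ennreal (lev * (2 ^ m * defect z) ^ (CARD('n) + 1)) < (\<integral>\<^sup>+w. g w * indicator (nball z (2 ^ m * defect z)) w \<partial>?V)} \<subseteq> S \<and>
        (\<integral>\<^sup>+z. ennreal (defect z powr b) * indicator S z \<partial>?V)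
          \<le> ennreal (2 * C1 * q ^ m / lev) * (\<integral>\<^sup>+w. g w * ennreal (defect w powr b) \<partial>?V)"
    if b: "-1/2 \<le> b" "b \<le> 0" and l: "0 < lev" and g[measurable]: "g \<in> borel_measurable ?V" for b lev g m
  proof -
    define r where "r z = 2 ^ m * defect z" for z :: "complex ^ 'n"
    define U where "U z = nball z (r z)" for z :: "complex ^ 'n"
    define E where "E = {z \<in> ball 0 1. ennreal (lev * r z ^ (CARD('n) + 1)) < (\<integral>\<^sup>+w. g w * indicator (U z) w \<partial>?V)}"
    have E1: "norm z < 1" if "z \<in> E" for z using that by (simp add: E_def)
    have rpos: "0 < r z" if "z \<in> E" for z
      using defect_pos[OF E1[OF that]] by (simp add: r_def)
    have Une: "U z \<noteq> {}" if "z \<in> E" for z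
    proof
      assume "U z = {}"
      then have "(\<integral>\<^sup>+w. g w * indicator (U z) w \<partial>?V) = 0" by simp
      then show False using that by (simp add: E_def)
    qed
    obtain D where D: "D \<subseteq> E" "disjoint_family_on U D"
      and sel: "\<And>x. x \<in> E \<Longrightarrow> \<exists>y\<in>D. U x \<inter> U y \<noteq> {} \<and> r x \<le> 2 * r y"
    proof (rule Vitali_selection[where S=E and U=U and r=r and R="2 ^ m"])
      show "0 < r x \<and> r x \<le> 2 ^ m" if "x \<in> E" for x
        using rpos[OF that] by (simp add: r_def)
      show "U x \<noteq> {}" if "x \<in> E" for x using Une[OF that] by blast
    qed blast
    have inj: "inj_on U D"
      using D Une by (fastforce simp: inj_on_def disjoint_family_on_def)
    \<comment> \<open>Disjoint nonempty open sets are countably many; countability makes the cover measurable.\<close>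
    have "countable (U ` D)"
    proof (rule countable_disjoint_open_subsets)
      show "disjoint (U ` D)" using D(2) by (rule disjoint_family_on_disjoint_image)
    qed (auto simp: U_def open_nball)
    then have cnt: "countable D" using inj by (rule countable_image_inj_on)
    define Q where "Q y = nball y (12 * r y) \<inter> {z. defect z \<le> 2 * r y / 2 ^ m}" for y
    have Qb[measurable]: "Q y \<in> sets borel" for y unfolding Q_def by measurable
    define S where "S = (\<Union>y\<in>D. Q y)"
    have Sb[measurable]: "S \<in> sets borel" unfolding S_def using cnt by (intro sets.countable_UN') auto
    have Sball: "S \<subseteq> ball 0 1" by (auto simp: S_def Q_def nball_def)
    have S: "S \<in> sets ?V" using sets_V_ball_borel[OF Sb] Sball by (simp add: Int_absorb1)
    have "E \<subseteq> S"
    proof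
      fix x assume x: "x \<in> E"
      then obtain y u where y: "y \<in> D" "u \<in> U x" "u \<in> U y" "r x \<le> 2 * r y" using sel by blast
      then have "norm y < 1" using D E1 by blast
      then have "x \<in> nball y (12 * r y)"
        using y E1[OF x] nball_subset_nball[of u x "r x" y "r y"] by (simp add: U_def)
      moreover have "defect x \<le> 2 * r y / 2 ^ m"
        using y by (simp add: r_def field_simps)
      ultimately show "x \<in> S" using y by (auto simp: S_def Q_def)
    qed
    \<comment> \<open>The largeness of the \<open>g\<close>-mass that defines \<open>E\<close>, with the weight moved inside the integral.\<close>
    have wt: "ennreal (r y powr (real (CARD('n) + 1) + b)) \<le> ennreal (2 / lev) * (\<integral>\<^sup>+w. g w * ennreal (defect w powr b) * indicator (U y) w \<partial>?V)"
      if "y \<in> D" for y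
    proof -
      have yE: "y \<in> E" using that D by blast
      note R = rpos[OF yE]
      have Ub: "(\<lambda>w. indicator (U y) w :: ennreal) \<in> borel_measurable ?V"
        unfolding U_def by (intro measurable_V_ball) measurable
      have "ennreal (r y powr (real (CARD('n) + 1) + b)) = ennreal (r y powr b / lev * (lev * r y ^ (CARD('n) + 1)))"
        using R l powr_realpow[OF R, of "CARD('n) + 1"] by (simp add: powr_add)
      also have "\<dots> = ennreal (r y powr b / lev) * ennreal (lev * r y ^ (CARD('n) + 1))"
        using R l by (intro ennreal_mult) auto
      also have "\<dots> \<le> ennreal (r y powr b / lev) * (\<integral>\<^sup>+w. g w * indicator (U y) w \<partial>?V)"
        using yE by (intro mult_left_mono) (auto simp: E_def)
      also have "\<dots> = (\<integral>\<^sup>+w. ennreal (r y powr b / lev) * (g w * indicator (U y) w) \<partial>?V)"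
        using Ub by (subst nn_integral_cmult) auto
      also have "\<dots> \<le> (\<integral>\<^sup>+w. ennreal (2 / lev) * (g w * ennreal (defect w powr b) * indicator (U y) w) \<partial>?V)"
      proof (rule nn_integral_mono)
        fix w assume w: "w \<in> space ?V"
        show "ennreal (r y powr b / lev) * (g w * indicator (U y) w)
          \<le> ennreal (2 / lev) * (g w * ennreal (defect w powr b) * indicator (U y) w)"
        proof (cases "w \<in> U y")
          case True
          have "0 < defect w" using w by (intro defect_pos) simp
          moreover have "defect w < 2 * r y"
            using True E1[OF yE] unfolding U_def by (rule defect_less_of_nball)
          ultimately have "(2 * r y) powr b \<le> defect w powr b" using b by (intro powr_mono2') auto
          moreover have "(1/2) * r y powr b \<le> 2 powr b * r y powr b"
            using b powr_mono[of "-1" b "2::real"] by (intro mult_right_mono) (auto simp: powr_minus_divide)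
          moreover have "(2 * r y) powr b = 2 powr b * r y powr b"
            using R by (simp add: powr_mult)
          ultimately have "r y powr b \<le> 2 * defect w powr b" by linarith
          then have "r y powr b / lev \<le> 2 / lev * defect w powr b"
            using l by (simp add: divide_right_mono)
          then have "ennreal (r y powr b / lev) \<le> ennreal (2 / lev) * ennreal (defect w powr b)"
            using l by (simp add: ennreal_mult[symmetric] ennreal_leI)
          then have "ennreal (r y powr b / lev) * g w \<le> ennreal (2 / lev) * ennreal (defect w powr b) * g w"
            by (rule mult_right_mono) simp
          then show ?thesis using True by (simp add: mult_ac)
        qed simp
      qed
      also have "\<dots> = ennreal (2 / lev) * (\<integral>\<^sup>+w. g w * ennreal (defect w powr b) * indicator (U y) w \<partial>?V)"
      proof -
        have "(\<lambda>w. ennreal (defect w powr b)) \<in> borel_measurable ?V"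
          by (intro measurable_V_ball) measurable
        then show ?thesis using Ub by (subst nn_integral_cmult) auto
      qed
      finally show ?thesis .
    qed
    have db: "(\<lambda>w. ennreal (defect w powr b)) \<in> borel_measurable ?V"
      by (intro measurable_V_ball) measurable
    have "(\<integral>\<^sup>+z. ennreal (defect z powr b) * indicator S z \<partial>?V)
      \<le> (\<integral>\<^sup>+y. (\<integral>\<^sup>+z. ennreal (defect z powr b) * indicator (Q y) z \<partial>?V) \<partial>count_space D)"
    proof -
      have "(\<integral>\<^sup>+z. ennreal (defect z powr b) * indicator S z \<partial>?V)
        \<le> (\<integral>\<^sup>+z. (\<integral>\<^sup>+y. ennreal (defect z powr b) * indicator (Q y) z \<partial>count_space D) \<partial>?V)"
      proof (rule nn_integral_mono)
        fix z
        show "ennreal (defect z powr b) * indicator S z \<le> (\<integral>\<^sup>+y. ennreal (defect z powr b) * indicator (Q y) z \<partial>count_space D)"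
        proof (cases "z \<in> S")
          case True
          then obtain y where y: "y \<in> D" "z \<in> Q y" by (auto simp: S_def)
          have "ennreal (defect z powr b) = (\<integral>\<^sup>+y'. ennreal (defect z powr b) * indicator {y} y' \<partial>count_space D)"
            using y by (subst nn_integral_cmult_indicator) auto
          also have "\<dots> \<le> (\<integral>\<^sup>+y. ennreal (defect z powr b) * indicator (Q y) z \<partial>count_space D)"
            using y by (intro nn_integral_mono) (auto simp: indicator_def)
          finally show ?thesis using True by simp
        qed simp
      qed
      also have "\<dots> = (\<integral>\<^sup>+y. (\<integral>\<^sup>+z. ennreal (defect z powr b) * indicator (Q y) z \<partial>?V) \<partial>count_space D)"
        using cnt by (intro nn_integral_count_space_nn_integral measurable_V_ball) measurable
      finally show ?thesis .
    qed
    also have "\<dots> \<le> (\<integral>\<^sup>+y. ennreal (2 * C1 * q ^ m / lev) * (\<integral>\<^sup>+w. g w * ennreal (defect w powr b) * indicator (U y) w \<partial>?V) \<partial>count_space D)"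
    proof (rule nn_integral_mono)
      fix y assume "y \<in> space (count_space D)"
      then have y: "y \<in> D" by simp
      have "(\<integral>\<^sup>+z. ennreal (defect z powr b) * indicator (Q y) z \<partial>?V) \<le> ennreal (C1 * q ^ m * r y powr (real (CARD('n) + 1) + b))"
        unfolding Q_def using y D E1 rpos by (intro cap b) auto
      also have "\<dots> = ennreal (C1 * q ^ m) * ennreal (r y powr (real (CARD('n) + 1) + b))"
        using C1 q by (intro ennreal_mult) auto
      also have "\<dots> \<le> ennreal (C1 * q ^ m) * (ennreal (2 / lev) * (\<integral>\<^sup>+w. g w * ennreal (defect w powr b) * indicator (U y) w \<partial>?V))"
        by (intro mult_left_mono wt y) simp
      also have "\<dots> = ennreal (2 * C1 * q ^ m / lev) * (\<integral>\<^sup>+w. g w * ennreal (defect w powr b) * indicator (U y) w \<partial>?V)"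
      proof -
        have "ennreal (C1 * q ^ m) * ennreal (2 / lev) = ennreal (C1 * q ^ m * (2 / lev))"
          using C1 q l by (intro ennreal_mult[symmetric]) auto
        also have "C1 * q ^ m * (2 / lev) = 2 * C1 * q ^ m / lev" by simp
        finally show ?thesis by (simp only: mult.assoc[symmetric])
      qed
      finally show "(\<integral>\<^sup>+z. ennreal (defect z powr b) * indicator (Q y) z \<partial>?V)
        \<le> ennreal (2 * C1 * q ^ m / lev) * (\<integral>\<^sup>+w. g w * ennreal (defect w powr b) * indicator (U y) w \<partial>?V)" .
    qed
    also have "\<dots> = ennreal (2 * C1 * q ^ m / lev) * (\<integral>\<^sup>+y. (\<integral>\<^sup>+w. g w * ennreal (defect w powr b) * indicator (U y) w \<partial>?V) \<partial>count_space D)"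
      by (intro nn_integral_cmult) simp
    also have "(\<integral>\<^sup>+y. (\<integral>\<^sup>+w. g w * ennreal (defect w powr b) * indicator (U y) w \<partial>?V) \<partial>count_space D)
        = (\<integral>\<^sup>+w. (\<integral>\<^sup>+y. g w * ennreal (defect w powr b) * indicator (U y) w \<partial>count_space D) \<partial>?V)"
    proof (rule nn_integral_count_space_nn_integral[OF cnt, symmetric])
      fix y
      have "(\<lambda>w. indicator (U y) w :: ennreal) \<in> borel_measurable ?V"
        unfolding U_def by (intro measurable_V_ball) measurable
      then show "(\<lambda>w. g w * ennreal (defect w powr b) * indicator (U y) w) \<in> borel_measurable ?V"
        using db by measurable
    qed
    also have "\<dots> \<le> (\<integral>\<^sup>+w. g w * ennreal (defect w powr b) \<partial>?V)"
    proof (rule nn_integral_mono)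
      fix w
      show "(\<integral>\<^sup>+y. g w * ennreal (defect w powr b) * indicator (U y) w \<partial>count_space D) \<le> g w * ennreal (defect w powr b)"
      proof (cases "\<exists>y\<in>D. w \<in> U y")
        case True
        then obtain y where y: "y \<in> D" "w \<in> U y" by blast
        have "(\<integral>\<^sup>+y. g w * ennreal (defect w powr b) * indicator (U y) w \<partial>count_space D)
          = (\<integral>\<^sup>+y'. g w * ennreal (defect w powr b) * indicator {y} y' \<partial>count_space D)"
          using y D(2) by (intro nn_integral_cong) (auto simp: indicator_def disjoint_family_on_def)
        also have "\<dots> = g w * ennreal (defect w powr b)"
          using y by (subst nn_integral_cmult_indicator) auto
        finally show ?thesis by simp
      next
        case False
        then have "(\<integral>\<^sup>+y. g w * ennreal (defect w powr b) * indicator (U y) w \<partial>count_space D) = (\<integral>\<^sup>+y. 0 \<partial>count_space D)"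
          by (intro nn_integral_cong) auto
        then show ?thesis by simp
      qed
    qed
    finally have "(\<integral>\<^sup>+z. ennreal (defect z powr b) * indicator S z \<partial>?V)
      \<le> ennreal (2 * C1 * q ^ m / lev) * (\<integral>\<^sup>+w. g w * ennreal (defect w powr b) \<partial>?V)"
      by (simp add: mult_left_mono)
    then show ?thesis using S \<open>E \<subseteq> S\<close> unfolding E_def U_def r_def by blast
  qed
  moreover have "0 < 2 * C1" using C1 by simp
  ultimately show ?thesis unfolding q_def by blast
qed

text \<open>The levels \<open>t * q ^ m\<close> sum to a multiple of \<open>t\<close>, while the measures of the exceptional sets
  are of order \<open>(q * q) ^ m / q ^ m = q ^ m\<close>. The choice \<open>q = 2 powr (-1/8)\<close>, half the exponent gained in
  \<open>Vitali_level_bound\<close>, makes both series converge.\<close>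

lemma weak_type_Vitali_range:
  "\<exists>C>0. \<forall>(b::real) g. \<forall>t>0. -1/2 \<le> b \<longrightarrow> b \<le> 0 \<longrightarrow> g \<in> borel_measurable (V_ball :: (complex ^ 'n) measure) \<longrightarrow>
     (\<exists>S\<in>sets V_ball. {z \<in> ball 0 1. ennreal t < abs_proj g z} \<subseteq> S \<and>
        ennreal t * (\<integral>\<^sup>+z. ennreal (defect z powr b) * indicator S z \<partial>V_ball)
          \<le> ennreal C * (\<integral>\<^sup>+w. g w * ennreal (defect w powr b) \<partial>V_ball))"
proof -
  let ?V = "V_ball :: (complex ^ 'n) measure"
  define k where "k = CARD('n) + 1"
  obtain C where C: "0 < C" and level: "\<And>(b::real) g lev m. -1/2 \<le> b \<Longrightarrow> b \<le> 0 \<Longrightarrow> 0 < lev \<Longrightarrow> g \<in> borel_measurable ?V \<Longrightarrow>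
     \<exists>S\<in>sets ?V.
        {z \<in> ball 0 1. ennreal (lev * (2 ^ m * defect z) ^ k) < (\<integral>\<^sup>+w. g w * indicator (nball z (2 ^ m * defect z)) w \<partial>?V)} \<subseteq> S \<and>
        (\<integral>\<^sup>+z. ennreal (defect z powr b) * indicator S z \<partial>?V)
          \<le> ennreal (C * (2 powr (-1/4)) ^ m / lev) * (\<integral>\<^sup>+w. g w * ennreal (defect w powr b) \<partial>?V)"
    using Vitali_level_bound[where 'n='n] unfolding k_def by blast
  define q :: real where "q = 2 powr (-1/8)"
  have q: "0 < q" "q < 1" using powr_less_mono[of "-1/8" 0 "2::real"] by (auto simp: q_def)
  have q2: "2 powr (-1/4) = q * q" by (simp add: q_def powr_add[symmetric])
  \<comment> \<open>Chosen so that \<open>2 ^ k * c * t * (\<Sum>m. q ^ m) = t\<close>.\<close>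
  define c where "c = (1 - q) / 2 ^ k"
  have c: "0 < c" using q by (simp add: c_def)
  define C' where "C' = C / c / (1 - q)"
  have "\<exists>S\<in>sets ?V. {z \<in> ball 0 1. ennreal t < abs_proj g z} \<subseteq> S \<and>
        ennreal t * (\<integral>\<^sup>+z. ennreal (defect z powr b) * indicator S z \<partial>?V)
          \<le> ennreal C' * (\<integral>\<^sup>+w. g w * ennreal (defect w powr b) \<partial>?V)"
    if t: "0 < t" and b: "-1/2 \<le> b" "b \<le> 0" and g: "g \<in> borel_measurable ?V" for b t :: real and g
  proof -
    let ?I = "\<lambda>m z. \<integral>\<^sup>+w. g w * indicator (nball z (2 ^ m * defect z)) w \<partial>?V"
    let ?N = "\<integral>\<^sup>+w. g w * ennreal (defect w powr b) \<partial>?V"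
    have lev: "0 < c * t * q ^ m" for m using c t q by simp
    have "\<forall>m. \<exists>S\<in>sets ?V. {z \<in> ball 0 1. ennreal (c * t * q ^ m * (2 ^ m * defect z) ^ k) < ?I m z} \<subseteq> S \<and>
        (\<integral>\<^sup>+z. ennreal (defect z powr b) * indicator S z \<partial>?V)
          \<le> ennreal (C * (2 powr (-1/4)) ^ m / (c * t * q ^ m)) * ?N"
      using level[OF b lev g] by blast
    then have "\<exists>S. \<forall>m. S m \<in> sets ?V \<and>
        {z \<in> ball 0 1. ennreal (c * t * q ^ m * (2 ^ m * defect z) ^ k) < ?I m z} \<subseteq> S m \<and>
        (\<integral>\<^sup>+z. ennreal (defect z powr b) * indicator (S m) z \<partial>?V)
          \<le> ennreal (C * (2 powr (-1/4)) ^ m / (c * t * q ^ m)) * ?N"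
      unfolding Bex_def by (rule choice)
    then obtain S where *: "\<forall>m. S m \<in> sets ?V \<and>
        {z \<in> ball 0 1. ennreal (c * t * q ^ m * (2 ^ m * defect z) ^ k) < ?I m z} \<subseteq> S m \<and>
        (\<integral>\<^sup>+z. ennreal (defect z powr b) * indicator (S m) z \<partial>?V)
          \<le> ennreal (C * (2 powr (-1/4)) ^ m / (c * t * q ^ m)) * ?N" by (rule exE)
    have S[measurable]: "S m \<in> sets ?V" for m
      using spec[OF *, of m] by (elim conjE)
    have sub: "{z \<in> ball 0 1. ennreal (c * t * q ^ m * (2 ^ m * defect z) ^ k) < ?I m z} \<subseteq> S m" for m
      using spec[OF *, of m] by (elim conjE)
    have mass: "(\<integral>\<^sup>+z. ennreal (defect z powr b) * indicator (S m) z \<partial>?V)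
          \<le> ennreal (C * (2 powr (-1/4)) ^ m / (c * t * q ^ m)) * ?N" for m
      using spec[OF *, of m] by (elim conjE)
    have db[measurable]: "(\<lambda>w. ennreal (defect w powr b)) \<in> borel_measurable ?V"
      by (intro measurable_V_ball) measurable
    have "{z \<in> ball 0 1. ennreal t < abs_proj g z} \<subseteq> (\<Union>m. S m)"
    proof (rule subsetI, rule ccontr)
      fix z assume z: "z \<in> {z \<in> ball 0 1. ennreal t < abs_proj g z}" and out: "z \<notin> (\<Union>m. S m)"
      have d: "0 < defect z" using z by (intro defect_pos) simp
      have "abs_proj g z \<le> (\<Sum>m. ennreal ((2 / (2 ^ m * defect z)) ^ k) * ?I m z)"
        unfolding abs_proj_def k_def using z by (intro abs_kernel_dyadic g) auto
      also have "\<dots> \<le> (\<Sum>m. ennreal (2 ^ k * c * t * q ^ m))"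
      proof (intro suminf_le summableI)
        fix m
        have "?I m z \<le> ennreal (c * t * q ^ m * (2 ^ m * defect z) ^ k)"
        proof (rule leI, rule notI)
          assume "ennreal (c * t * q ^ m * (2 ^ m * defect z) ^ k) < ?I m z"
          then have "z \<in> S m" using sub[of m] z by blast
          then show False using out by blast
        qed
        then have "ennreal ((2 / (2 ^ m * defect z)) ^ k) * ?I m z
           \<le> ennreal ((2 / (2 ^ m * defect z)) ^ k) * ennreal (c * t * q ^ m * (2 ^ m * defect z) ^ k)"
          by (rule mult_left_mono) simp
        also have "\<dots> = ennreal ((2 / (2 ^ m * defect z)) ^ k * (c * t * q ^ m * (2 ^ m * defect z) ^ k))"
          using d c t q by (subst ennreal_mult) auto
        also have "(2 / (2 ^ m * defect z)) ^ k * (c * t * q ^ m * (2 ^ m * defect z) ^ k)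
           = (2 / (2 ^ m * defect z) * (2 ^ m * defect z)) ^ k * (c * t * q ^ m)"
          unfolding power_mult_distrib by (simp only: mult_ac)
        also have "2 / (2 ^ m * defect z) * (2 ^ m * defect z) = 2"
          using d by simp
        finally show "ennreal ((2 / (2 ^ m * defect z)) ^ k) * ?I m z \<le> ennreal (2 ^ k * c * t * q ^ m)"
          by (simp only: mult.assoc)
      qed
      also have "\<dots> = ennreal (2 ^ k * c * t / (1 - q))"
        using c t q by (intro suminf_geometric_ennreal) auto
      also have "2 ^ k * c * t / (1 - q) = t" using q by (simp add: c_def)
      finally have "\<not> ennreal t < abs_proj g z" by (rule leD)
      then show False using z by blast
    qed
    moreover have "ennreal t * (\<integral>\<^sup>+z. ennreal (defect z powr b) * indicator (\<Union>m. S m) z \<partial>?V) \<le> ennreal C' * ?N"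
    proof -
      have "(\<integral>\<^sup>+z. ennreal (defect z powr b) * indicator (\<Union>m. S m) z \<partial>?V) = emeasure (density ?V (\<lambda>z. ennreal (defect z powr b))) (\<Union>m. S m)"
        by (rule emeasure_density[OF db, symmetric]) measurable
      also have "\<dots> \<le> (\<Sum>m. emeasure (density ?V (\<lambda>z. ennreal (defect z powr b))) (S m))"
        by (rule emeasure_subadditive_countably) auto
      also have "\<dots> = (\<Sum>m. \<integral>\<^sup>+z. ennreal (defect z powr b) * indicator (S m) z \<partial>?V)"
        by (simp only: emeasure_density[OF db S])
      also have "\<dots> \<le> (\<Sum>m. ennreal (C / (c * t) * q ^ m) * ?N)"
      proof (intro suminf_le summableI)
        fix m
        have "C * (2 powr (-1/4)) ^ m / (c * t * q ^ m) = C / (c * t) * q ^ m"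
          using q unfolding q2 power_mult_distrib by simp
        then show "(\<integral>\<^sup>+z. ennreal (defect z powr b) * indicator (S m) z \<partial>?V) \<le> ennreal (C / (c * t) * q ^ m) * ?N"
          using mass[of m] by simp
      qed
      also have "\<dots> = ennreal (C / (c * t) / (1 - q)) * ?N"
      proof -
        have "0 \<le> C / (c * t)" "0 \<le> q" using C c t q by auto
        then show ?thesis
          using q(2) by (simp only: ennreal_suminf_multc suminf_geometric_ennreal)
      qed
      finally have "ennreal t * (\<integral>\<^sup>+z. ennreal (defect z powr b) * indicator (\<Union>m. S m) z \<partial>?V)
          \<le> ennreal t * (ennreal (C / (c * t) / (1 - q)) * ?N)"
        by (rule mult_left_mono) simp
      also have "\<dots> = ennreal (t * (C / (c * t) / (1 - q))) * ?N"
        using C c t q by (subst ennreal_mult) (auto simp: mult.assoc)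
      also have "t * (C / (c * t) / (1 - q)) = C'" using t by (simp add: C'_def)
      finally show ?thesis .
    qed
    ultimately show ?thesis by (intro bexI[of _ "\<Union>m. S m"] conjI) measurable
  qed
  moreover have "0 < C'" using C c q by (simp add: C'_def)
  ultimately show ?thesis by blast
qed

section \<open>The weak-type bound\<close>

lemma abs_proj_weak_type:
  "\<exists>C>0. \<forall>(b::real) g. \<forall>t>0. -1 < b \<longrightarrow> b \<le> 0 \<longrightarrow> g \<in> borel_measurable (V_ball :: (complex ^ 'n) measure) \<longrightarrow>
     (\<exists>S\<in>sets V_ball. {z \<in> ball 0 1. ennreal t < abs_proj g z} \<subseteq> S \<and>
        ennreal t * (\<integral>\<^sup>+z. ennreal (defect z powr b) * indicator S z \<partial>V_ball)
          \<le> ennreal (C / (1 + b)) * (\<integral>\<^sup>+w. g w * ennreal (defect w powr b) \<partial>V_ball))"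
proof -
  let ?V = "V_ball :: (complex ^ 'n) measure"
  let ?P = "\<lambda>(b::real) g t A. \<exists>S\<in>sets ?V. {z \<in> ball 0 1. ennreal t < abs_proj g z} \<subseteq> S \<and>
        ennreal t * (\<integral>\<^sup>+z. ennreal (defect z powr b) * indicator S z \<partial>?V)
          \<le> A * (\<integral>\<^sup>+w. g w * ennreal (defect w powr b) \<partial>?V)"
  obtain C1 where C1: "0 < C1" "\<And>b g t. 0 < t \<Longrightarrow> -1 < b \<Longrightarrow> b \<le> -1/2 \<Longrightarrow> g \<in> borel_measurable ?V \<Longrightarrow> ?P b g t (ennreal (C1 / (1 + b)))"
    using weak_type_strong_range[where 'n='n] by blast
  obtain C2 where C2: "0 < C2" "\<And>b g t. 0 < t \<Longrightarrow> -1/2 \<le> b \<Longrightarrow> b \<le> 0 \<Longrightarrow> g \<in> borel_measurable ?V \<Longrightarrow> ?P b g t (ennreal C2)"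
    using weak_type_Vitali_range[where 'n='n] by blast
  have mono: "?P b g t B" if "?P b g t A" "A \<le> B" for b g t A B
    using that by (meson mult_right_mono order_trans zero_le)
  have "?P b g t (ennreal ((C1 + C2) / (1 + b)))"
    if "0 < t" and b: "-1 < b" "b \<le> 0" and "g \<in> borel_measurable ?V" for b g t
  proof (cases "b \<le> -1/2")
    case True
    show ?thesis
      by (rule mono[OF C1(2)]) (use that True C1 C2 in \<open>auto intro!: ennreal_leI divide_right_mono\<close>)
  next
    case False
    have "C2 * (1 + b) \<le> C1 + C2 * 1" using C1 C2 b by (intro add_increasing mult_left_mono) auto
    then have "C2 \<le> (C1 + C2) / (1 + b)" using b by (simp add: pos_le_divide_eq)
    then show ?thesis
      by (intro mono[OF C2(2)]) (use that False in \<open>auto intro!: ennreal_leI\<close>)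
  qed
  moreover have "0 < C1 + C2" using C1 C2 by simp
  ultimately show ?thesis by blast
qed

lemma norm_bergman_projection_le:
  assumes "f \<in> borel_measurable V_ball"
  shows "ennreal (norm (bergman_projection f z)) \<le> abs_proj (\<lambda>w. ennreal (norm (f w))) z"
proof -
  let ?F = "\<lambda>w. f w / (1 - herm z w) ^ (CARD('a) + 1)"
  have "ennreal (norm (integral\<^sup>L V_ball ?F)) \<le> (\<integral>\<^sup>+w. ennreal (norm (?F w)) \<partial>V_ball)"
  proof (cases "integrable V_ball ?F")
    case True
    then show ?thesis by (rule integral_norm_bound_ennreal)
  next
    case False
    then show ?thesis by (simp add: not_integrable_integral_eq)
  qed
  also have "\<dots> = abs_proj (\<lambda>w. ennreal (norm (f w))) z"
    unfolding abs_proj_def abs_kernel_def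
    by (intro nn_integral_cong) (simp add: norm_divide norm_mult norm_power ennreal_mult[symmetric])
  finally show ?thesis by (simp add: bergman_projection_def)
qed

lemma std_weight_const_nonneg: "0 \<le> std_weight_const TYPE('n::finite) b"
  by (simp add: std_weight_const_def integral_nonneg_AE)

theorem corollary1p12:
  shows "\<exists>C::real. C > 0 \<and> (\<forall>b::real. -1 < b \<and> b \<le> 0 \<longrightarrow>
    weak_type_norm (std_weight b :: complex ^ 'n::finite \<Rightarrow> real) bergman_projection
      \<le> ennreal (C / (1 + b) * ln (exp 1 + 1 / (1 + b))))"
proof -
  let ?V = "V_ball :: (complex ^ 'n) measure"
  obtain C where C: "0 < C" and weak: "\<And>(b::real) g t. 0 < t \<Longrightarrow> -1 < b \<Longrightarrow> b \<le> 0 \<Longrightarrow> g \<in> borel_measurable ?V \<Longrightarrow>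
     \<exists>S\<in>sets ?V. {z \<in> ball 0 1. ennreal t < abs_proj g z} \<subseteq> S \<and>
        ennreal t * (\<integral>\<^sup>+z. ennreal (defect z powr b) * indicator S z \<partial>?V)
          \<le> ennreal (C / (1 + b)) * (\<integral>\<^sup>+w. g w * ennreal (defect w powr b) \<partial>?V)"
    using abs_proj_weak_type[where 'n='n] by blast
  have "weak_type_norm (std_weight b :: complex ^ 'n \<Rightarrow> real) bergman_projection
      \<le> ennreal (C / (1 + b) * ln (exp 1 + 1 / (1 + b)))" if b: "-1 < b" "b \<le> 0" for b
  proof -
    define c where "c = std_weight_const TYPE('n) b"
    have c: "0 \<le> c" unfolding c_def by (rule std_weight_const_nonneg)
    have weight: "ennreal (std_weight b z) = ennreal c * ennreal (defect z powr b)" for z :: "complex ^ 'n"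
      using c by (simp add: std_weight_def c_def ennreal_mult)
    have db[measurable]: "(\<lambda>w. ennreal (defect w powr b)) \<in> borel_measurable ?V"
      by (intro measurable_V_ball) measurable
    have "weak_L1_norm (std_weight b) (bergman_projection f) \<le> ennreal (C / (1 + b)) * L1_norm (std_weight b) f"
      if f: "f \<in> L1 (std_weight b)" for f :: "complex ^ 'n \<Rightarrow> complex"
      unfolding weak_L1_norm_def
    proof (rule SUP_least)
      fix t :: real assume "t \<in> {0<..}"
      then have t: "0 < t" by simp
      have fm[measurable]: "f \<in> borel_measurable ?V" using f by (simp add: L1_def)
      obtain S where S[measurable]: "S \<in> sets ?V"
        and sub: "{z \<in> ball 0 1. ennreal t < abs_proj (\<lambda>w. ennreal (norm (f w))) z} \<subseteq> S"
        and bound: "ennreal t * (\<integral>\<^sup>+z. ennreal (defect z powr b) * indicator S z \<partial>?V)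
          \<le> ennreal (C / (1 + b)) * (\<integral>\<^sup>+w. ennreal (norm (f w)) * ennreal (defect w powr b) \<partial>?V)"
        using weak[OF t b, of "\<lambda>w. ennreal (norm (f w))"] by auto
      have incl: "{z \<in> ball 0 1. t < norm (bergman_projection f z)} \<subseteq> S"
      proof
        fix z assume z: "z \<in> {z \<in> ball 0 1. t < norm (bergman_projection f z)}"
        then have "ennreal t < ennreal (norm (bergman_projection f z))"
          using t by (simp add: ennreal_less_iff)
        also have "\<dots> \<le> abs_proj (\<lambda>w. ennreal (norm (f w))) z"
          by (rule norm_bergman_projection_le[OF fm])
        finally show "z \<in> S" using sub z by auto
      qed
      have "weight_mass (std_weight b) {z \<in> ball 0 1. t < norm (bergman_projection f z)}
        \<le> (\<integral>\<^sup>+z. ennreal c * (ennreal (defect z powr b) * indicator S z) \<partial>?V)"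
        unfolding weight_mass_def using incl
        by (intro nn_integral_mono) (auto simp: weight mult.assoc indicator_def)
      also have "\<dots> = ennreal c * (\<integral>\<^sup>+z. ennreal (defect z powr b) * indicator S z \<partial>?V)"
        by (subst nn_integral_cmult) auto
      finally have "ennreal t * weight_mass (std_weight b) {z \<in> ball 0 1. t < norm (bergman_projection f z)}
        \<le> ennreal t * (ennreal c * (\<integral>\<^sup>+z. ennreal (defect z powr b) * indicator S z \<partial>?V))"
        by (rule mult_left_mono) simp
      also have "\<dots> = ennreal c * (ennreal t * (\<integral>\<^sup>+z. ennreal (defect z powr b) * indicator S z \<partial>?V))"
        by (simp only: mult_ac)
      also have "\<dots> \<le> ennreal c * (ennreal (C / (1 + b)) * (\<integral>\<^sup>+w. ennreal (norm (f w)) * ennreal (defect w powr b) \<partial>?V))"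
        by (rule mult_left_mono[OF bound]) simp
      also have "\<dots> = ennreal (C / (1 + b)) * (ennreal c * (\<integral>\<^sup>+w. ennreal (norm (f w)) * ennreal (defect w powr b) \<partial>?V))"
        by (simp only: mult_ac)
      also have "ennreal c * (\<integral>\<^sup>+w. ennreal (norm (f w)) * ennreal (defect w powr b) \<partial>?V) = L1_norm (std_weight b) f"
        unfolding L1_norm_def
        by (subst nn_integral_cmult[symmetric])
           (auto simp: ennreal_mult' weight[symmetric] mult.left_commute[of "ennreal c"] intro!: nn_integral_cong)
      finally show "ennreal t * weight_mass (std_weight b) {z \<in> ball 0 1. t < norm (bergman_projection f z)}
        \<le> ennreal (C / (1 + b)) * L1_norm (std_weight b) f" .
    qed
    then have "weak_type_norm (std_weight b :: complex ^ 'n \<Rightarrow> real) bergman_projection \<le> ennreal (C / (1 + b))"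
      unfolding weak_type_norm_def by (intro Inf_lower) auto
    also have "\<dots> \<le> ennreal (C / (1 + b) * ln (exp 1 + 1 / (1 + b)))"
    proof (rule ennreal_leI)
      have "exp 1 \<le> exp 1 + 1 / (1 + b)" using b by simp
      moreover have "0 < exp 1 + 1 / (1 + b)" using b by (simp add: add_pos_pos)
      ultimately have "1 \<le> ln (exp 1 + 1 / (1 + b))" by (simp add: ln_ge_iff)
      then have "C / (1 + b) * 1 \<le> C / (1 + b) * ln (exp 1 + 1 / (1 + b))"
        using C b by (intro mult_left_mono) auto
      then show "C / (1 + b) \<le> C / (1 + b) * ln (exp 1 + 1 / (1 + b))" by simp
    qed
    finally show ?thesis .
  qed
  then show ?thesis using C by blast
qed

end
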